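(* Assume (H4): for each $\alpha\in\mathcal A$ and each $(x,p)\in\Gamma_\alpha\times\mathbb R$ there exists a unique $a^\star_\alpha=a^\star_\alpha(x,p)$ with $|a^\star_\alpha|\le R$ such that $$H_\alpha(x,p)=-b_\alpha(x,a^\star_\alpha)p-\ell_\alpha(x,a^\star_\alpha),$$ and the map $a^\star_\alpha:\Gamma_\alpha\times\mathbb R\to\mathbb R$ is continuous; here $H_\alpha(x,p)=\sup_{|a|\le R}\{-b_\alpha(x,a)p-\ell_\alpha(x,a)\}$. Let $u\in\mathscr C^2(\Gamma)$ be a solution to $$\begin{cases}-\mu_\alpha\partial^2u(x)+H(x,\partial u(x))+\lambda u(x)=F(x)&\text{for all }x\in\Gamma_\alpha\setminus\mathcal V,\ \alpha\in\mathcal A,\\ u_{|\Gamma_\alpha}(v)=u_{|\Gamma_\beta}(v)&\text{for all }\alpha,\beta\in\mathcal A_v,\ v\in\mathcal V,\\ \sum_{\alpha\in\mathcal A_v}\mu_\alpha\gamma_{v,\alpha}\,\partial_\alpha u(v)=\eta_v(\theta_v-\lambda u(v))&\text{for all }v\in\mathcal V\setminus\partial\mathcal V,\\ \partial_\alpha u(v)=0&\text{for all }v\in\partial\mathcal V,\ \alpha\in\mathcal A_v,\end{cases}$$ where $H=H_\alpha$ on $\Gamma_\alpha$. Then $u(x)\ge V(x)$ for all $x\in\Gamma$, where $V(x)=\inf_{a\in\mathfrak A}J(x,a)$.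
   Context: Network. $\mathcal V\subset\mathbb R^d$ is a finite set of vertices; $P\subset\mathcal V\times\mathcal V$ contains no pair $(v,v)$, and every vertex occurs in at least one pair of $P$. The edges are the segments joining the two points of a pair in $P$, indexed as $\Gamma_\alpha$, $\alpha\in\mathcal A$ ($\mathcal A$ finite); for $\alpha\ne\beta$, $\Gamma_\alpha\cap\Gamma_\beta=\{v\}$ if both edges contain the vertex $v$, and $\Gamma_\alpha\cap\Gamma_\beta=\varnothing$ otherwise. The network $\Gamma=\bigcup_{\alpha}\Gamma_\alpha$ is assumed connected and carries its geodesic distance. $\mathcal A_v=\{\alpha\in\mathcal A: v\in\Gamma_\alpha\}$; $\partial\mathcal V$ is the set of boundary vertices, i.e. those $v$ for which there is a unique $\bar v\in\mathcal V$ with $(v,\bar v)\in P$ or $(\bar v,v)\in P$. An edge $\Gamma_\alpha$ with vertices $v_i,v_j$ and length $L_\alpha$ is parametrized by $\pi_\alpha(s)=v_i+s\,e_\alpha$, $e_\alpha=(v_j-v_i)/L_\alpha$, $s\in[0,L_\alpha]$. For $u:\Gamma\to\mathbb R$, $u_\alpha=u\circ\pi_\alpha$ on $(0,L_\alpha)$, and $u_{|\Gamma_\alpha}(v)$ is the limit of $u_\alpha$ at the endpoint corresponding to $v\in\Gamma_\alpha$. $\partial u$, $\partial^2u$ inside $\Gamma_\alpha$ are derivatives of $u_\alpha$ with respect to $s$. At a vertex $v\in\Gamma_\alpha$, $\partial_\alpha u(v)$ is the outward derivative: $-u_\alpha'(0)$ if $v=\pi_\alpha(0)$, $u_\alpha'(L_\alpha)$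 if $v=\pi_\alpha(L_\alpha)$. Spaces. $\mathscr C(\Gamma)$: continuous functions on $\Gamma$. $\mathscr C^k(\Gamma)$: continuous functions on $\Gamma$ with $u_\alpha\in C^k([0,L_\alpha])$ for all $\alpha$. $\mathcal{PC}(\Gamma)$: functions $u:\Gamma\to\mathbb R$ with each $u_\alpha$ continuous on $(0,L_\alpha)$ with finite limits at the endpoints, $\|u\|_{\mathcal{PC}(\Gamma)}=\max_\alpha\|u_\alpha\|_{L^\infty(0,L_\alpha)}$; $PC(\Gamma)$ is its quotient identifying functions that agree on the interior of every edge. Data. $\lambda>0$; $\mu_\alpha>0$ for $\alpha\in\mathcal A$; for $v\in\mathcal V\setminus\partial\mathcal V$ and $\alpha\in\mathcal A_v$: $\gamma_{v,\alpha}>0$, $\eta_v\ge0$, $\theta_v\in\mathbb R$, with $\sum_{\alpha\in\mathcal A_v}\mu_\alpha\gamma_{v,\alpha}=1$. $b:\Gamma\times\mathbb R\to\mathbb R$ and $\ell:\Gamma\times\mathbb R\to\mathbb R$ have continuous restrictions $b_\alpha,\ell_\alpha$ to $\Gamma_\alpha\times\mathbb R$ for every $\alpha$. $F\in PC(\Gamma)$. $R>0$ and the set of controls is $\mathfrak A=\{a\in\mathcal{PC}(\Gamma):\|a\|_{\mathcal{PC}(\Gamma)}\le R\}$. Controlled process. For $a\in\mathfrak A$, let $\mathcal G^a$ be the operator $\mathcal G^a f(x)=\mu_\alpha\partial^2f(x)+b_\alpha(x,a_\alpha(x))\,\partial f(x)$, $x\in\Gamma_\alpha\setminus\mathcal V$,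 $\alpha\in\mathcal A$, with domain $D(\mathcal G^a)$ the set of $f\in\mathscr C^2(\Gamma)$ such that $\mathcal G^af\in\mathscr C(\Gamma)$ (i.e. extends continuously to $\Gamma$), $\eta_v\mathcal G^af(v)+\sum_{\alpha\in\mathcal A_v}\mu_\alpha\gamma_{v,\alpha}\partial_\alpha f(v)=0$ for all $v\in\mathcal V\setminus\partial\mathcal V$, and $\partial_\alpha f(v)=0$ for all $v\in\partial\mathcal V$. It is known that $\mathcal G^a$ generates a Feller (strong Markov) process on $\Gamma$ with continuous paths; $X^a$ denotes this process with initial distribution $\delta_x$, and $\mathbb E_x$ the expectation. Cost. For $x\in\Gamma$, $a\in\mathfrak A$, $$J(x,a)=\mathbb E_x\Big[\int_0^{+\infty}e^{-\lambda s}\Big(\big(\ell(X^a(s),a(X^a(s)))+F(X^a(s))\big)\mathbf 1_{\{X^a(s)\notin\mathcal V\}}+\sum_{v\in\mathcal V\setminus\partial\mathcal V}\theta_v\mathbf 1_{\{X^a(s)=v\}}\Big)ds\Big].$$ *)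

theory Defs
  imports "HOL-Probability.Probability"
begin

section \<open>Networks\<close>

text \<open>
  The index set of the edges is \<open>edges\<close>; the edge with index \<open>\<alpha>\<close> joins \<open>src \<alpha>\<close> to \<open>tgt \<alpha>\<close> and is
  parametrized by arc length starting from \<open>src \<alpha>\<close>. The orientation is free: a pair of \<open>pairs\<close> may be
  run through in either direction.
\<close>

record ('a, 'i) network =
  verts :: "'a set"
  pairs :: "('a \<times> 'a) set"
  edges :: "'i set"
  src :: "'i \<Rightarrow> 'a"
  tgt :: "'i \<Rightarrow> 'a"

definition edge :: "('a::euclidean_space, 'i) network \<Rightarrow> 'i \<Rightarrow> 'a set" where
  "edge N \<alpha> = closed_segment (src N \<alpha>) (tgt N \<alpha>)"

definition net :: "('a::euclidean_space, 'i) network \<Rightarrow> 'a set" where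
  "net N = (\<Union>\<alpha>\<in>edges N. edge N \<alpha>)"

text \<open>
  In the intersection condition, ``the edge contains the vertex \<open>v\<close>'' means that \<open>v\<close> is one of its two
  end points. Then no vertex lies in the relative interior of an edge (there are no T-junctions), and
  distinct indices have distinct edges.
\<close>

definition is_network :: "('a::euclidean_space, 'i) network \<Rightarrow> bool" where
  "is_network N \<longleftrightarrow>
     finite (verts N) \<and> pairs N \<subseteq> verts N \<times> verts N \<and> (\<forall>v. (v, v) \<notin> pairs N) \<and>
     (\<forall>v\<in>verts N. \<exists>w. (v, w) \<in> pairs N \<or> (w, v) \<in> pairs N) \<and>
     finite (edges N) \<and>
     (\<forall>\<alpha>\<in>edges N. (src N \<alpha>, tgt N \<alpha>) \<in> pairs N \<or> (tgt N \<alpha>, src N \<alpha>) \<in> pairs N) \<and>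
     (\<forall>(v, w)\<in>pairs N. \<exists>\<alpha>\<in>edges N. edge N \<alpha> = closed_segment v w) \<and>
     (\<forall>\<alpha>\<in>edges N. \<forall>\<beta>\<in>edges N. \<alpha> \<noteq> \<beta> \<longrightarrow>
        (\<forall>v. v \<in> {src N \<alpha>, tgt N \<alpha>} \<inter> {src N \<beta>, tgt N \<beta>} \<longrightarrow> edge N \<alpha> \<inter> edge N \<beta> = {v}) \<and>
        ({src N \<alpha>, tgt N \<alpha>} \<inter> {src N \<beta>, tgt N \<beta>} = {} \<longrightarrow> edge N \<alpha> \<inter> edge N \<beta> = {})) \<and>
     connected (net N)"

definition edges_at :: "('a::euclidean_space, 'i) network \<Rightarrow> 'a \<Rightarrow> 'i set" where
  "edges_at N v = {\<alpha> \<in> edges N. v \<in> edge N \<alpha>}"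

definition bdry :: "('a::euclidean_space, 'i) network \<Rightarrow> 'a set" where
  "bdry N = {v \<in> verts N. \<exists>!w. w \<in> verts N \<and> ((v, w) \<in> pairs N \<or> (w, v) \<in> pairs N)}"

definition len :: "('a::euclidean_space, 'i) network \<Rightarrow> 'i \<Rightarrow> real" where
  "len N \<alpha> = dist (src N \<alpha>) (tgt N \<alpha>)"

definition param :: "('a::euclidean_space, 'i) network \<Rightarrow> 'i \<Rightarrow> real \<Rightarrow> 'a" where
  "param N \<alpha> s = src N \<alpha> + s *\<^sub>R ((tgt N \<alpha> - src N \<alpha>) /\<^sub>R len N \<alpha>)"

text \<open>The inverse of \<^term>\<open>param N \<alpha>\<close> on the edge.\<close>

definition coord :: "('a::euclidean_space, 'i) network \<Rightarrow> 'i \<Rightarrow> 'a \<Rightarrow> real" where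
  "coord N \<alpha> x = dist (src N \<alpha>) x"

lemma coord_param:
  assumes "s \<ge> 0" "len N \<alpha> > 0" shows "coord N \<alpha> (param N \<alpha> s) = s"
  using assms by (simp add: coord_def param_def len_def dist_norm norm_minus_commute)

lemma param_coord:
  assumes "x \<in> edge N \<alpha>" "len N \<alpha> > 0" shows "param N \<alpha> (coord N \<alpha> x) = x"
proof -
  obtain t where t: "0 \<le> t" "x = src N \<alpha> + t *\<^sub>R (tgt N \<alpha> - src N \<alpha>)"
    using assms(1) by (auto simp: edge_def closed_segment_def algebra_simps)
  have "coord N \<alpha> x = t * len N \<alpha>"
    using t by (simp add: coord_def len_def dist_norm norm_minus_commute)
  then show ?thesis using t assms(2) by (simp add: param_def)
qed

section \<open>The geodesic distance\<close>

text \<open>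
  Shortest chains of points, consecutive ones lying in a common edge. Lemma \<open>continuous_geo_dist\<close>
  below shows that this distance induces on the network its topology as a subset of the Euclidean
  space, so that continuity on the network is \<^const>\<open>continuous_on\<close>.
\<close>

definition geo_dist :: "('a::euclidean_space, 'i) network \<Rightarrow> 'a \<Rightarrow> 'a \<Rightarrow> ereal" where
  "geo_dist N x y =
     (INF xs\<in>{xs. xs \<noteq> [] \<and> hd xs = x \<and> last xs = y \<and>
                 successively (\<lambda>z w. \<exists>\<alpha>\<in>edges N. z \<in> edge N \<alpha> \<and> w \<in> edge N \<alpha>) xs}.
        ereal (sum_list (map2 dist xs (tl xs))))"

lemma dist_le_chain:
  "xs \<noteq> [] \<Longrightarrow> dist (hd xs) (last xs) \<le> sum_list (map2 dist xs (tl xs))"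
proof (induction xs rule: induct_list012)
  case (3 x y zs)
  have "dist x (last (y # zs)) \<le> dist x y + dist y (last (y # zs))" by (rule dist_triangle)
  then show ?case using 3 by simp
qed auto

lemma dist_le_geo_dist: "ereal (dist x y) \<le> geo_dist N x y"
  unfolding geo_dist_def by (rule INF_greatest) (use dist_le_chain in auto)

lemma geo_dist_edge:
  assumes "\<alpha> \<in> edges N" "x \<in> edge N \<alpha>" "y \<in> edge N \<alpha>"
  shows "geo_dist N x y = ereal (dist x y)"
proof (rule antisym)
  show "geo_dist N x y \<le> ereal (dist x y)"
    unfolding geo_dist_def by (rule INF_lower2[where i = "[x, y]"]) (use assms in auto)
qed (rule dist_le_geo_dist)

lemma geo_dist_local:
  assumes "finite (edges N)"
  obtains d where "d > 0" "\<And>y. y \<in> net N \<Longrightarrow> dist x y < d \<Longrightarrow> x \<in> net N \<Longrightarrow> geo_dist N x y = ereal (dist x y)"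
proof -
  define C where "C = (\<Union>\<alpha>\<in>{\<alpha>\<in>edges N. x \<notin> edge N \<alpha>}. edge N \<alpha>)"
  have "closed C" unfolding C_def edge_def using assms by (intro closed_UN) auto
  then have "open (- C)" by (simp add: open_Compl)
  moreover have "x \<in> - C" by (simp add: C_def)
  ultimately obtain d where d: "d > 0" "ball x d \<subseteq> - C" using open_contains_ball by blast
  show ?thesis
  proof (rule that[OF d(1)])
    fix y assume "y \<in> net N" "dist x y < d"
    then obtain \<alpha> where "\<alpha> \<in> edges N" "y \<in> edge N \<alpha>" "x \<in> edge N \<alpha>"
      using d(2) by (force simp: net_def C_def subset_iff)
    then show "geo_dist N x y = ereal (dist x y)" by (rule_tac geo_dist_edge)
  qed
qed

lemma continuous_geo_dist:
  fixes f :: "'a::euclidean_space \<Rightarrow> 'b::metric_space"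
  assumes "is_network N"
  shows "continuous_on (net N) f \<longleftrightarrow>
    (\<forall>x\<in>net N. \<forall>\<epsilon>>0. \<exists>\<delta>>0. \<forall>y\<in>net N. geo_dist N x y < ereal \<delta> \<longrightarrow> dist (f y) (f x) < \<epsilon>)"
    (is "_ \<longleftrightarrow> ?R")
proof
  assume "continuous_on (net N) f"
  then show ?R
    unfolding continuous_on_iff
    by (metis dist_commute dist_le_geo_dist ereal_less_le less_ereal.simps(1) order_le_less_trans)
next
  assume R: ?R
  show "continuous_on (net N) f"
    unfolding continuous_on_iff
  proof (intro ballI allI impI)
    fix x \<epsilon> assume x: "x \<in> net N" and "0 < (\<epsilon>::real)"
    then obtain \<delta> where \<delta>: "\<delta> > 0"
      "\<And>y. y \<in> net N \<Longrightarrow> geo_dist N x y < ereal \<delta> \<Longrightarrow> dist (f y) (f x) < \<epsilon>"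
      using R by blast
    have "finite (edges N)" using assms by (simp add: is_network_def)
    then obtain d where d: "d > 0" "\<And>y. y \<in> net N \<Longrightarrow> dist x y < d \<Longrightarrow> geo_dist N x y = ereal (dist x y)"
      using geo_dist_local[of N x] x by metis
    show "\<exists>d>0. \<forall>x'\<in>net N. dist x' x < d \<longrightarrow> dist (f x') (f x) < \<epsilon>"
      by (rule exI[where x = "min d \<delta>"]) (use d \<delta> in \<open>auto simp: dist_commute\<close>)
  qed
qed

section \<open>Functions on networks\<close>

text \<open>
  Functions on the network are functions on the whole space of which only the values on
  \<^term>\<open>net N\<close> matter. Derivatives at the end points of \<open>[0, L\<^sub>\<alpha>]\<close> are one-sided.
\<close>

fun Ck_on :: "nat \<Rightarrow> real set \<Rightarrow> (real \<Rightarrow> real) \<Rightarrow> bool" where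
  "Ck_on 0 S f = continuous_on S f"
| "Ck_on (Suc k) S f =
     (\<exists>f'. (\<forall>s\<in>S. (f has_real_derivative f' s) (at s within S)) \<and> Ck_on k S f')"

definition Ck_net :: "nat \<Rightarrow> ('a::euclidean_space, 'i) network \<Rightarrow> ('a \<Rightarrow> real) \<Rightarrow> bool" where
  "Ck_net k N u \<longleftrightarrow> continuous_on (net N) u \<and> (\<forall>\<alpha>\<in>edges N. Ck_on k {0..len N \<alpha>} (u \<circ> param N \<alpha>))"

definition d1 :: "('a::euclidean_space, 'i) network \<Rightarrow> 'i \<Rightarrow> ('a \<Rightarrow> real) \<Rightarrow> 'a \<Rightarrow> real" where
  "d1 N \<alpha> u x = vector_derivative (u \<circ> param N \<alpha>) (at (coord N \<alpha> x) within {0..len N \<alpha>})"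

definition d2 :: "('a::euclidean_space, 'i) network \<Rightarrow> 'i \<Rightarrow> ('a \<Rightarrow> real) \<Rightarrow> 'a \<Rightarrow> real" where
  "d2 N \<alpha> u = d1 N \<alpha> (d1 N \<alpha> u)"

definition outward_deriv ::
  "('a::euclidean_space, 'i) network \<Rightarrow> 'i \<Rightarrow> ('a \<Rightarrow> real) \<Rightarrow> 'a \<Rightarrow> real" where
  "outward_deriv N \<alpha> u v = (if v = src N \<alpha> then - d1 N \<alpha> u v else d1 N \<alpha> u v)"

definition edge_limit :: "('a::euclidean_space, 'i) network \<Rightarrow> 'i \<Rightarrow> ('a \<Rightarrow> real) \<Rightarrow> 'a \<Rightarrow> real" where
  "edge_limit N \<alpha> u v = Lim (at (coord N \<alpha> v) within {0<..<len N \<alpha>}) (u \<circ> param N \<alpha>)"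

definition PC_net :: "('a::euclidean_space, 'i) network \<Rightarrow> ('a \<Rightarrow> real) \<Rightarrow> bool" where
  "PC_net N u \<longleftrightarrow> (\<forall>\<alpha>\<in>edges N. continuous_on {0<..<len N \<alpha>} (u \<circ> param N \<alpha>) \<and>
     (\<exists>l. ((u \<circ> param N \<alpha>) \<longlongrightarrow> l) (at_right 0)) \<and>
     (\<exists>l. ((u \<circ> param N \<alpha>) \<longlongrightarrow> l) (at_left (len N \<alpha>))))"

definition PC_norm :: "('a::euclidean_space, 'i) network \<Rightarrow> ('a \<Rightarrow> real) \<Rightarrow> ereal" where
  "PC_norm N u =
     Max ((\<lambda>\<alpha>. esssup (lebesgue_on {0<..<len N \<alpha>}) (\<lambda>s. ereal \<bar>u (param N \<alpha> s)\<bar>)) ` edges N)"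

definition controls :: "('a::euclidean_space, 'i) network \<Rightarrow> real \<Rightarrow> ('a \<Rightarrow> real) set" where
  "controls N R = {a. PC_net N a \<and> PC_norm N a \<le> ereal R}"

section \<open>The controlled process\<close>

text \<open>\<open>gen_graph N \<mu> \<gamma> \<eta> b a f g\<close>: \<open>f\<close> is in the domain of \<open>\<G>\<^sup>a\<close>, and \<open>g\<close> is
  the continuous extension of \<open>\<G>\<^sup>a f\<close> to the network.\<close>

definition gen_graph ::
  "('a::euclidean_space, 'i) network \<Rightarrow> ('i \<Rightarrow> real) \<Rightarrow> ('a \<Rightarrow> 'i \<Rightarrow> real) \<Rightarrow> ('a \<Rightarrow> real) \<Rightarrow>
   ('a \<Rightarrow> real \<Rightarrow> real) \<Rightarrow> ('a \<Rightarrow> real) \<Rightarrow> ('a \<Rightarrow> real) \<Rightarrow> ('a \<Rightarrow> real) \<Rightarrow> bool" where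
  "gen_graph N \<mu> \<gamma> \<eta> b a f g \<longleftrightarrow>
     Ck_net 2 N f \<and> continuous_on (net N) g \<and>
     (\<forall>\<alpha>\<in>edges N. \<forall>x\<in>edge N \<alpha> - verts N. g x = \<mu> \<alpha> * d2 N \<alpha> f x + b x (a x) * d1 N \<alpha> f x) \<and>
     (\<forall>v\<in>verts N - bdry N.
        \<eta> v * g v + (\<Sum>\<alpha>\<in>edges_at N v. \<mu> \<alpha> * \<gamma> v \<alpha> * outward_deriv N \<alpha> f v) = 0) \<and>
     (\<forall>v\<in>bdry N. \<forall>\<alpha>\<in>edges_at N v. outward_deriv N \<alpha> f v = 0)"

text \<open>Strongly continuous positive contraction semigroups on the continuous functions on a compact
  set \<open>K\<close>.\<close>

definition feller_semigroup ::
  "'a::euclidean_space set \<Rightarrow> (real \<Rightarrow> ('a \<Rightarrow> real) \<Rightarrow> ('a \<Rightarrow> real)) \<Rightarrow> bool" where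
  "feller_semigroup K T \<longleftrightarrow>
     (\<forall>t\<ge>0. \<forall>f. continuous_on K f \<longrightarrow> continuous_on K (T t f)) \<and>
     (\<forall>t\<ge>0. \<forall>f g c d. continuous_on K f \<longrightarrow> continuous_on K g \<longrightarrow>
        (\<forall>x\<in>K. T t (\<lambda>y. c * f y + d * g y) x = c * T t f x + d * T t g x)) \<and>
     (\<forall>t\<ge>0. \<forall>f. continuous_on K f \<longrightarrow> (\<forall>x\<in>K. 0 \<le> f x \<and> f x \<le> 1) \<longrightarrow>
        (\<forall>x\<in>K. 0 \<le> T t f x \<and> T t f x \<le> 1)) \<and>
     (\<forall>f. continuous_on K f \<longrightarrow> (\<forall>x\<in>K. T 0 f x = f x)) \<and>
     (\<forall>s\<ge>0. \<forall>t\<ge>0. \<forall>f. continuous_on K f \<longrightarrow> (\<forall>x\<in>K. T (s + t) f x = T s (T t f) x)) \<and>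
     (\<forall>f. continuous_on K f \<longrightarrow> uniform_limit K (\<lambda>t. T t f) f (at_right 0))"

definition semigroup_generator ::
  "'a::euclidean_space set \<Rightarrow> (real \<Rightarrow> ('a \<Rightarrow> real) \<Rightarrow> ('a \<Rightarrow> real)) \<Rightarrow>
   ('a \<Rightarrow> real) \<Rightarrow> ('a \<Rightarrow> real) \<Rightarrow> bool" where
  "semigroup_generator K T f g \<longleftrightarrow> continuous_on K f \<and> continuous_on K g \<and>
     uniform_limit K (\<lambda>t x. (T t f x - f x) / t) g (at_right 0)"

definition natural_filtration ::
  "'w measure \<Rightarrow> (real \<Rightarrow> 'w \<Rightarrow> 'a::euclidean_space) \<Rightarrow> real \<Rightarrow> 'w measure" where
  "natural_filtration M X s = sigma (space M) {X r -` B \<inter> space M | r B. 0 \<le> r \<and> r \<le> s \<and> B \<in> sets borel}"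

definition continuous_feller_process ::
  "'a::euclidean_space set \<Rightarrow> (real \<Rightarrow> ('a \<Rightarrow> real) \<Rightarrow> ('a \<Rightarrow> real)) \<Rightarrow> 'a \<Rightarrow>
   'w measure \<Rightarrow> (real \<Rightarrow> 'w \<Rightarrow> 'a) \<Rightarrow> bool" where
  "continuous_feller_process K T x M X \<longleftrightarrow>
     prob_space M \<and> (\<forall>t\<ge>0. X t \<in> borel_measurable M) \<and>
     (\<forall>\<omega>\<in>space M. (\<forall>t\<ge>0. X t \<omega> \<in> K) \<and> continuous_on {0..} (\<lambda>t. X t \<omega>)) \<and>
     distr M borel (X 0) = return borel x \<and>
     (\<forall>s\<ge>0. \<forall>t\<ge>0. \<forall>f. continuous_on K f \<longrightarrow>
        (AE \<omega> in M. real_cond_exp M (natural_filtration M X s) (\<lambda>\<omega>. f (X (s + t) \<omega>)) \<omega> = T t f (X s \<omega>)))"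

text \<open>\<open>X\<close> on \<open>M\<close> is the Feller process generated by \<open>\<G>\<^sup>a\<close>, with initial distribution
  the Dirac mass at \<open>x\<close>. The strong Markov property is a consequence of the Feller property.\<close>

definition controlled_process ::
  "('a::euclidean_space, 'i) network \<Rightarrow> ('i \<Rightarrow> real) \<Rightarrow> ('a \<Rightarrow> 'i \<Rightarrow> real) \<Rightarrow> ('a \<Rightarrow> real) \<Rightarrow>
   ('a \<Rightarrow> real \<Rightarrow> real) \<Rightarrow> ('a \<Rightarrow> real) \<Rightarrow> 'a \<Rightarrow> 'w measure \<Rightarrow> (real \<Rightarrow> 'w \<Rightarrow> 'a) \<Rightarrow> bool" where
  "controlled_process N \<mu> \<gamma> \<eta> b a x M X \<longleftrightarrow>
     (\<exists>T. feller_semigroup (net N) T \<and>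
          (\<forall>f g. semigroup_generator (net N) T f g \<longleftrightarrow> gen_graph N \<mu> \<gamma> \<eta> b a f g) \<and>
          continuous_feller_process (net N) T x M X)"

section \<open>Cost, value function, Hamiltonian\<close>

definition cost ::
  "('a::euclidean_space, 'i) network \<Rightarrow> ('a \<Rightarrow> real) \<Rightarrow> ('a \<Rightarrow> real \<Rightarrow> real) \<Rightarrow> ('a \<Rightarrow> real) \<Rightarrow> real \<Rightarrow>
   ('a \<Rightarrow> real) \<Rightarrow> 'w measure \<Rightarrow> (real \<Rightarrow> 'w \<Rightarrow> 'a) \<Rightarrow> real" where
  "cost N \<theta> l F lam a M X =
     (LINT \<omega>|M. (LINT s:{0..}|lborel. exp (- lam * s) *
        ((l (X s \<omega>) (a (X s \<omega>)) + F (X s \<omega>)) * indicator (- verts N) (X s \<omega>) +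
         (\<Sum>v\<in>verts N - bdry N. \<theta> v * indicator {v} (X s \<omega>)))))"

text \<open>\<open>M a x\<close> and \<open>X a x\<close> are the probability space and the process for the control \<open>a\<close> and the
  starting point \<open>x\<close>.\<close>

definition value_fun ::
  "('a::euclidean_space, 'i) network \<Rightarrow> ('a \<Rightarrow> real) \<Rightarrow> ('a \<Rightarrow> real \<Rightarrow> real) \<Rightarrow> ('a \<Rightarrow> real) \<Rightarrow> real \<Rightarrow>
   real \<Rightarrow> (('a \<Rightarrow> real) \<Rightarrow> 'a \<Rightarrow> 'w measure) \<Rightarrow> (('a \<Rightarrow> real) \<Rightarrow> 'a \<Rightarrow> real \<Rightarrow> 'w \<Rightarrow> 'a) \<Rightarrow> 'a \<Rightarrow> real" where
  "value_fun N \<theta> l F lam R M X x = (INF a\<in>controls N R. cost N \<theta> l F lam a (M a x) (X a x))"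

definition hamiltonian ::
  "('a \<Rightarrow> real \<Rightarrow> real) \<Rightarrow> ('a \<Rightarrow> real \<Rightarrow> real) \<Rightarrow> real \<Rightarrow> 'a \<Rightarrow> real \<Rightarrow> real" where
  "hamiltonian b l R x p = (SUP a\<in>{a. \<bar>a\<bar> \<le> R}. - b x a * p - l x a)"

definition H4 ::
  "('a::euclidean_space, 'i) network \<Rightarrow> ('a \<Rightarrow> real \<Rightarrow> real) \<Rightarrow> ('a \<Rightarrow> real \<Rightarrow> real) \<Rightarrow> real \<Rightarrow> bool" where
  "H4 N b l R \<longleftrightarrow>
     (\<forall>\<alpha>\<in>edges N.
        (\<forall>x\<in>edge N \<alpha>. \<forall>p. \<exists>!a. \<bar>a\<bar> \<le> R \<and> hamiltonian b l R x p = - b x a * p - l x a) \<and>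
        continuous_on (edge N \<alpha> \<times> UNIV)
          (\<lambda>(x, p). THE a. \<bar>a\<bar> \<le> R \<and> hamiltonian b l R x p = - b x a * p - l x a))"

definition HJB_solution ::
  "('a::euclidean_space, 'i) network \<Rightarrow> ('i \<Rightarrow> real) \<Rightarrow> ('a \<Rightarrow> 'i \<Rightarrow> real) \<Rightarrow> ('a \<Rightarrow> real) \<Rightarrow> ('a \<Rightarrow> real) \<Rightarrow>
   ('a \<Rightarrow> real \<Rightarrow> real) \<Rightarrow> ('a \<Rightarrow> real) \<Rightarrow> real \<Rightarrow> ('a \<Rightarrow> real) \<Rightarrow> bool" where
  "HJB_solution N \<mu> \<gamma> \<eta> \<theta> H F lam u \<longleftrightarrow>
     (\<forall>\<alpha>\<in>edges N. \<forall>x\<in>edge N \<alpha> - verts N.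
        - \<mu> \<alpha> * d2 N \<alpha> u x + H x (d1 N \<alpha> u x) + lam * u x = F x) \<and>
     (\<forall>v\<in>verts N. \<forall>\<alpha>\<in>edges_at N v. \<forall>\<beta>\<in>edges_at N v. edge_limit N \<alpha> u v = edge_limit N \<beta> u v) \<and>
     (\<forall>v\<in>verts N - bdry N.
        (\<Sum>\<alpha>\<in>edges_at N v. \<mu> \<alpha> * \<gamma> v \<alpha> * outward_deriv N \<alpha> u v) = \<eta> v * (\<theta> v - lam * u v)) \<and>
     (\<forall>v\<in>bdry N. \<forall>\<alpha>\<in>edges_at N v. outward_deriv N \<alpha> u v = 0)"

end

theory Submission
  imports Defs
begin

text \<open>
  The idea is that the feedback control \<open>a(x) = a\<^sup>\<star>(x, \<partial>u(x))\<close>, defined from the solution \<open>u\<close>, has cost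
  exactly \<open>u(x)\<close>. It is admissible because \<open>a\<^sup>\<star>\<close> and \<open>\<partial>u\<close> are continuous on each closed edge, and so
  the infimum of the costs is at most \<open>u(x)\<close>.

  With this control the Hamilton-Jacobi-Bellman equation becomes the linear equation
  \<open>\<lambda> u - \<G>\<^sup>a u = q\<close>, where \<open>q\<close> is the running cost, and the cost is the resolvent \<open>E \<integral> e\<^bsup>-\<lambda>s\<^esup> q(X\<^sub>s) ds\<close>. If \<open>u\<close>
  were in the domain of the generator, lemma \<open>resolvent_formula\<close> would finish the proof. In general it
  is not, since \<open>\<G>\<^sup>a u\<close> can have different limits at a vertex along different edges, and \<open>q\<close> takes the
  separate value \<open>\<theta>\<^sub>v\<close> at an inner vertex \<open>v\<close> and \<open>0\<close> at a boundary vertex.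

  Lemma \<open>generator_approximation\<close> repairs this. Near the ends of each edge \<open>u\<close> is corrected by functions
  of shrinking support that have value and slope zero at the vertex but a prescribed second derivative
  there. The corrected functions \<open>f\<^sub>n\<close> are in the domain for any choice of the vertex values \<open>c(v)\<close> of
  \<open>\<G>\<^sup>a f\<^sub>n\<close> that is consistent with the vertex condition, and \<open>c(v) = \<lambda> u(v) - \<theta>\<^sub>v\<close> at inner vertices and
  \<open>c(v) = \<lambda> u(v)\<close> at boundary vertices is consistent precisely because \<open>u\<close> solves the vertex
  conditions of the equation. With these values \<open>\<lambda> f\<^sub>n - \<G>\<^sup>a f\<^sub>n\<close> converges boundedly and pointwise to
  \<open>q\<close>, at the vertices too. The resolvent formula for \<open>f\<^sub>n\<close> passes to the limit by dominated convergence
  (lemma \<open>resolvent_formula_limit\<close>). The time that the process spends at the vertices never has to be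
  computed.
\<close>

section \<open>The resolvent of a Feller process with continuous paths\<close>

text \<open>
  Fubini's theorem for the discounted cost needs joint measurability in time and chance. A path that
  is continuous is the limit of its values at the times of finer and finer grids, and a process
  read only at grid times is a countable case distinction between random variables.
\<close>

lemma borel_measurable_continuous_paths:
  fixes X :: "real \<Rightarrow> 'w \<Rightarrow> 'a::metric_space"
  assumes meas: "\<And>t. t \<ge> 0 \<Longrightarrow> X t \<in> borel_measurable M"
    and cont: "\<And>\<omega>. \<omega> \<in> space M \<Longrightarrow> continuous_on {0..} (\<lambda>t. X t \<omega>)"
  shows "(\<lambda>z. X (max 0 (snd z)) (fst z)) \<in> borel_measurable (M \<Otimes>\<^sub>M lborel)"
proof -
  define k where "k i s = nat \<lceil>max 0 s * real (Suc i)\<rceil>" for i :: nat and s :: real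
  define r where "r i s = real (k i s) / real (Suc i)" for i :: nat and s :: real
  have r_bounds: "max 0 s \<le> r i s" "r i s \<le> max 0 s + 1 / real (Suc i)" for i s
  proof -
    have "real (k i s) = of_int \<lceil>max 0 s * real (Suc i)\<rceil>"
      unfolding k_def by (intro of_nat_nat) (simp add: order_less_le_trans[of "- 1" 0])
    then have "max 0 s * real (Suc i) \<le> real (k i s)" "real (k i s) \<le> max 0 s * real (Suc i) + 1"
      by linarith+
    then show "max 0 s \<le> r i s" "r i s \<le> max 0 s + 1 / real (Suc i)"
      by (simp_all add: r_def pos_le_divide_eq pos_divide_le_eq distrib_right del: of_nat_Suc max.bounded_iff)
  qed
  show ?thesis
  proof (rule borel_measurable_LIMSEQ_metric)
    fix i
    have "k i \<in> measurable lborel (count_space UNIV)"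
      unfolding k_def[abs_def] by measurable
    then have "(\<lambda>z. k i (snd z)) \<in> measurable (M \<Otimes>\<^sub>M lborel) (count_space UNIV)"
      by (rule measurable_compose[OF measurable_snd])
    moreover have "(\<lambda>z. X (real j / real (Suc i)) (fst z)) \<in> borel_measurable (M \<Otimes>\<^sub>M lborel)" for j
      by (rule measurable_compose[OF measurable_fst meas]) simp
    ultimately show "(\<lambda>z. X (r i (snd z)) (fst z)) \<in> borel_measurable (M \<Otimes>\<^sub>M lborel)"
      unfolding r_def by (rule measurable_compose_countable[rotated])
  next
    fix z assume "z \<in> space (M \<Otimes>\<^sub>M (lborel :: real measure))"
    then have z: "fst z \<in> space M" by (auto simp: space_pair_measure)
    have "(\<lambda>i. r i (snd z)) \<longlonglongrightarrow> max 0 (snd z)"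
    proof (rule tendsto_sandwich[OF _ _ tendsto_const])
      show "(\<lambda>i. max 0 (snd z) + 1 / real (Suc i)) \<longlonglongrightarrow> max 0 (snd z)"
        using tendsto_add[OF tendsto_const LIMSEQ_inverse_real_of_nat, of "max 0 (snd z)"]
        by (simp add: inverse_eq_divide)
    qed (use r_bounds in auto)
    moreover have "r i (snd z) \<in> {0..}" for i by (simp add: r_def)
    ultimately show "(\<lambda>i. X (r i (snd z)) (fst z)) \<longlonglongrightarrow> X (max 0 (snd z)) (fst z)"
      by (intro continuous_on_tendsto_compose[OF cont[OF z]]) auto
  qed
qed

text \<open>
  The generator only gives difference quotients to the right, but uniformly in the starting time \<open>s\<close>.
  Read from \<open>s = t - h\<close>, this controls the left quotient at \<open>t\<close> as well, up to the increment of the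
  continuous function \<open>n\<close>; so the derivative is two-sided.
\<close>

lemma DERIV_from_uniform_right_quotient:
  fixes m n :: "real \<Rightarrow> real"
  assumes n: "continuous_on {0..} n"
    and quot: "\<And>\<delta>. \<delta> > 0 \<Longrightarrow>
      \<exists>h0>0. \<forall>s\<ge>0. \<forall>h. 0 < h \<and> h < h0 \<longrightarrow> \<bar>m (s + h) - m s - h * n s\<bar> \<le> h * \<delta>"
    and t: "t > 0"
  shows "(m has_real_derivative n t) (at t)"
  unfolding has_field_derivative_def has_derivative_at_alt
proof (intro conjI allI impI)
  show "bounded_linear ((*) (n t))" by (rule bounded_linear_mult_right)
next
  fix e :: real assume e: "e > 0"
  obtain h0 where h0: "h0 > 0"
    "\<And>s h. s \<ge> 0 \<Longrightarrow> 0 < h \<Longrightarrow> h < h0 \<Longrightarrow> \<bar>m (s + h) - m s - h * n s\<bar> \<le> h * (e/2)"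
    using quot[of "e/2"] e by auto
  obtain d where d: "d > 0" "\<And>s. s \<ge> 0 \<Longrightarrow> \<bar>s - t\<bar> < d \<Longrightarrow> \<bar>n s - n t\<bar> < e/2"
    using n[unfolded continuous_on_iff, rule_format, of t "e/2"] t e by (auto simp: dist_real_def)
  show "\<exists>d>0. \<forall>y. norm (y - t) < d \<longrightarrow> norm (m y - m t - n t * (y - t)) \<le> e * norm (y - t)"
  proof (intro exI[of _ "min t (min h0 d)"] conjI allI impI)
    fix y assume y: "norm (y - t) < min t (min h0 d)"
    consider "y = t" | "y > t" | "y < t" by linarith
    then show "norm (m y - m t - n t * (y - t)) \<le> e * norm (y - t)"
    proof cases
      case 2
      then have "\<bar>m (t + (y - t)) - m t - (y - t) * n t\<bar> \<le> (y - t) * (e/2)"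
        using y t by (intro h0) auto
      moreover have "(y - t) * (e/2) \<le> (y - t) * e" using 2 e by (intro mult_left_mono) auto
      moreover have "m (t + (y - t)) - m t - (y - t) * n t = m y - m t - n t * (y - t)" by simp
      ultimately have "\<bar>m y - m t - n t * (y - t)\<bar> \<le> (y - t) * e" by linarith
      then show ?thesis using 2 by (simp add: mult.commute)
    next
      case 3
      then have "\<bar>m (y + (t - y)) - m y - (t - y) * n y\<bar> \<le> (t - y) * (e/2)"
        using y t by (intro h0) auto
      moreover have "\<bar>(t - y) * (n y - n t)\<bar> \<le> (t - y) * (e/2)"
        unfolding abs_mult using 3 y t d(2)[of y] by (intro mult_mono) auto
      moreover have "m y - m t - n t * (y - t)
          = - (m (y + (t - y)) - m y - (t - y) * n y) - (t - y) * (n y - n t)"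
        by (simp add: algebra_simps)
      ultimately have "\<bar>m y - m t - n t * (y - t)\<bar> \<le> (t - y) * (e/2) + (t - y) * (e/2)"
        by linarith
      then show ?thesis using 3 by (simp add: algebra_simps)
    qed auto
  qed (use t h0 d in auto)
qed

lemma compact_continuous_bounded:
  fixes q :: "'a::metric_space \<Rightarrow> real"
  assumes "compact K" "continuous_on K q"
  obtains C where "C > 0" "\<And>x. x \<in> K \<Longrightarrow> \<bar>q x\<bar> \<le> C"
  using compact_imp_bounded[OF compact_continuous_image[OF assms(2,1)]]
  by (auto simp: bounded_pos)

lemma discount_integrable:
  fixes lam :: real
  assumes "lam > 0"
  shows "integrable lborel (\<lambda>s. indicator {0..} s * exp (- lam * s) :: real)"
proof -
  have "(\<lambda>s. exp (- lam * s)) integrable_on {0..}"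
    using has_integral_exp_minus_to_infinity[OF assms, of 0] by blast
  then have "(\<lambda>s. exp (- lam * s)) absolutely_integrable_on {0..}"
    by (rule nonnegative_absolutely_integrable_1) auto
  then have "integrable lebesgue (\<lambda>s. indicator {0..} s * exp (- lam * s))"
    by (simp add: set_integrable_def)
  then show ?thesis by (subst (asm) integrable_completion) auto
qed

text \<open>
  The process is studied only through the expectations \<open>E q(X\<^sub>t)\<close> of continuous functions \<open>q\<close> on
  the compact state space \<open>K\<close>. Being continuous only on \<open>K\<close>, such a \<open>q\<close> need not be Borel on the
  whole space; its composition with the process is measurable because the process stays in \<open>K\<close>.
\<close>

locale feller_process_on =
  fixes K :: "'a::euclidean_space set" and T x and M :: "'w measure" and X :: "real \<Rightarrow> 'w \<Rightarrow> 'a"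
  assumes compact: "compact K"
    and semigroup: "feller_semigroup K T"
    and process: "continuous_feller_process K T x M X"
    and start: "x \<in> K"
begin

sublocale prob_space M
  using process by (simp add: continuous_feller_process_def)

sublocale pair_sigma_finite M "lborel :: real measure" ..

lemma process_measurable: "t \<ge> 0 \<Longrightarrow> X t \<in> borel_measurable M"
  and process_in: "\<omega> \<in> space M \<Longrightarrow> t \<ge> 0 \<Longrightarrow> X t \<omega> \<in> K"
  and paths_continuous: "\<omega> \<in> space M \<Longrightarrow> continuous_on {0..} (\<lambda>t. X t \<omega>)"
  using process by (auto simp: continuous_feller_process_def)

lemma borel_measurable_on_state_space:
  fixes q :: "'a \<Rightarrow> real"
  assumes q: "continuous_on K q" and Y: "Y \<in> borel_measurable Q"
    and Y_in: "\<And>z. z \<in> space Q \<Longrightarrow> Y z \<in> K"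
  shows "(\<lambda>z. q (Y z)) \<in> borel_measurable Q"
proof -
  have "(\<lambda>y. indicator K y *\<^sub>R q y) \<in> borel_measurable borel"
    using compact q by (intro borel_measurable_continuous_on_indicator borel_compact) auto
  from measurable_compose[OF Y this] show ?thesis
    by (rule measurable_cong[THEN iffD1, rotated]) (simp add: Y_in)
qed

lemma observable_measurable:
  fixes q :: "'a \<Rightarrow> real"
  assumes "continuous_on K q" "t \<ge> 0"
  shows "(\<lambda>\<omega>. q (X t \<omega>)) \<in> borel_measurable M"
  using assms by (intro borel_measurable_on_state_space process_measurable process_in)

lemma observable_integrable:
  fixes q :: "'a \<Rightarrow> real"
  assumes "continuous_on K q" "t \<ge> 0"
  shows "integrable M (\<lambda>\<omega>. q (X t \<omega>))"
proof -
  obtain C where "\<And>y. y \<in> K \<Longrightarrow> \<bar>q y\<bar> \<le> C"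
    using compact_continuous_bounded[OF compact assms(1)] by metis
  then show ?thesis
    using assms by (intro integrable_const_bound[of _ C] AE_I2 observable_measurable) (auto simp: process_in)
qed

lemma expectation_abs_le:
  fixes q :: "'a \<Rightarrow> real"
  assumes "continuous_on K q" "t \<ge> 0" and C: "\<And>y. y \<in> K \<Longrightarrow> \<bar>q y\<bar> \<le> C"
  shows "\<bar>expectation (\<lambda>\<omega>. q (X t \<omega>))\<bar> \<le> C"
proof -
  have "\<bar>expectation (\<lambda>\<omega>. q (X t \<omega>))\<bar> \<le> expectation (\<lambda>\<omega>. \<bar>q (X t \<omega>)\<bar>)"
    by (rule integral_abs_bound)
  also have "\<dots> \<le> expectation (\<lambda>\<omega>. C)"
    by (intro integral_mono) (use assms in \<open>auto simp: observable_integrable process_in\<close>)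
  finally show ?thesis by (simp add: prob_space)
qed

lemma expectation_continuous:
  fixes q :: "'a \<Rightarrow> real"
  assumes q: "continuous_on K q"
  shows "continuous_on {0..} (\<lambda>t. expectation (\<lambda>\<omega>. q (X t \<omega>)))"
proof -
  obtain C where C: "\<And>y. y \<in> K \<Longrightarrow> \<bar>q y\<bar> \<le> C"
    using compact_continuous_bounded[OF compact q] by metis
  show ?thesis
    unfolding continuous_on_sequentially comp_def
  proof (intro allI ballI impI)
    fix s :: "nat \<Rightarrow> real" and t :: real
    assume t: "t \<in> {0..}" and s: "(\<forall>i. s i \<in> {0..}) \<and> s \<longlonglongrightarrow> t"
    show "(\<lambda>i. expectation (\<lambda>\<omega>. q (X (s i) \<omega>))) \<longlonglongrightarrow> expectation (\<lambda>\<omega>. q (X t \<omega>))"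
    proof (rule integral_dominated_convergence[where w = "\<lambda>_. C"])
      show "AE \<omega> in M. (\<lambda>i. q (X (s i) \<omega>)) \<longlonglongrightarrow> q (X t \<omega>)"
      proof (rule AE_I2)
        fix \<omega> assume w: "\<omega> \<in> space M"
        have "continuous_on {0..} (\<lambda>t. q (X t \<omega>))"
          by (rule continuous_on_compose2[OF q paths_continuous[OF w]]) (use process_in[OF w] in auto)
        then show "(\<lambda>i. q (X (s i) \<omega>)) \<longlonglongrightarrow> q (X t \<omega>)"
          by (rule continuous_on_tendsto_compose) (use s t in auto)
      qed
      show "(\<lambda>\<omega>. q (X t \<omega>)) \<in> borel_measurable M" using t by (simp add: observable_measurable q)
      show "(\<lambda>\<omega>. q (X (s i) \<omega>)) \<in> borel_measurable M" for i using s by (simp add: observable_measurable q)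
      show "AE \<omega> in M. norm (q (X (s i) \<omega>)) \<le> C" for i
        using s by (intro AE_I2) (auto intro!: C process_in)
    qed simp
  qed
qed

text \<open>
  The form in which the Markov property is needed: the conditioning on the past is integrated out, so
  the semigroup acts on the law of \<open>X\<^sub>s\<close>.
\<close>

lemma markov_expectation:
  fixes q :: "'a \<Rightarrow> real"
  assumes q: "continuous_on K q" and st: "s \<ge> 0" "t \<ge> 0"
  shows "expectation (\<lambda>\<omega>. q (X (s + t) \<omega>)) = expectation (\<lambda>\<omega>. T t q (X s \<omega>))"
proof -
  let ?F = "natural_filtration M X s"
  have Tq: "continuous_on K (T t q)" using semigroup q st by (simp add: feller_semigroup_def)
  let ?G = "{X r -` B \<inter> space M | r B. 0 \<le> r \<and> r \<le> s \<and> B \<in> sets borel}"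
  have "?G \<subseteq> sets M" using process_measurable by (auto intro: measurable_sets)
  then have "subalgebra M ?F"
    unfolding subalgebra_def natural_filtration_def
    by (simp add: sets.sigma_sets_subset space_measure_of_conv sets_measure_of[OF order_trans[OF _ sets.space_closed]])
  then interpret finite_measure_subalgebra M ?F by unfold_locales
  have "AE \<omega> in M. real_cond_exp M ?F (\<lambda>\<omega>. q (X (s + t) \<omega>)) \<omega> = T t q (X s \<omega>)"
    using process q st by (simp add: continuous_feller_process_def)
  then have "expectation (real_cond_exp M ?F (\<lambda>\<omega>. q (X (s + t) \<omega>))) = expectation (\<lambda>\<omega>. T t q (X s \<omega>))"
    by (rule integral_cong_AE[rotated 2]) (use observable_measurable[OF Tq] st in auto)
  then show ?thesis using real_cond_exp_int(2)[OF observable_integrable[OF q, of "s + t"]] st by simp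
qed

lemma expectation_start:
  fixes q :: "'a \<Rightarrow> real"
  assumes q: "continuous_on K q"
  shows "expectation (\<lambda>\<omega>. q (X 0 \<omega>)) = q x"
proof -
  let ?q = "\<lambda>y. indicator K y *\<^sub>R q y"
  have m: "?q \<in> borel_measurable borel"
    using compact q by (intro borel_measurable_continuous_on_indicator borel_compact) auto
  have "expectation (\<lambda>\<omega>. q (X 0 \<omega>)) = expectation (\<lambda>\<omega>. ?q (X 0 \<omega>))"
    by (intro Bochner_Integration.integral_cong) (auto simp: process_in)
  also have "\<dots> = (LINT y|distr M borel (X 0). ?q y)"
    by (intro integral_distr[symmetric] process_measurable m) simp
  also have "distr M borel (X 0) = return borel x"
    using process by (simp add: continuous_feller_process_def)
  also have "(LINT y|return borel x. ?q y) = ?q x"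
    using m by (intro integral_return) auto
  finally show ?thesis using start by simp
qed

text \<open>
  Kolmogorov's forward equation in weak form. By the Markov property the difference quotient of
  \<open>E f(X\<^sub>t)\<close> at \<open>s\<close> is the expectation of \<open>(T\<^sub>h f - f) / h\<close> at \<open>X\<^sub>s\<close>, and this function is
  uniformly close to \<open>g\<close> on \<open>K\<close>.
\<close>

lemma expectation_DERIV:
  assumes gen: "semigroup_generator K T f g" and t: "t > 0"
  shows "((\<lambda>t. expectation (\<lambda>\<omega>. f (X t \<omega>))) has_real_derivative expectation (\<lambda>\<omega>. g (X t \<omega>))) (at t)"
proof (rule DERIV_from_uniform_right_quotient[OF _ _ t])
  have f: "continuous_on K f" and g: "continuous_on K g"
    and lim: "uniform_limit K (\<lambda>t x. (T t f x - f x) / t) g (at_right 0)"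
    using gen by (auto simp: semigroup_generator_def)
  show "continuous_on {0..} (\<lambda>t. expectation (\<lambda>\<omega>. g (X t \<omega>)))" by (rule expectation_continuous[OF g])
  fix \<delta> :: real assume \<delta>: "\<delta> > 0"
  have "\<forall>\<^sub>F h in at_right 0. \<forall>y\<in>K. dist ((T h f y - f y) / h) (g y) < \<delta>"
    using lim \<delta> by (simp add: uniform_limit_iff)
  then obtain h0 where h0: "h0 > 0"
    "\<And>h y. 0 < h \<Longrightarrow> h < h0 \<Longrightarrow> y \<in> K \<Longrightarrow> \<bar>(T h f y - f y) / h - g y\<bar> < \<delta>"
    unfolding eventually_at_right_field dist_real_def by auto
  show "\<exists>h0>0. \<forall>s\<ge>0. \<forall>h. 0 < h \<and> h < h0 \<longrightarrow>
      \<bar>expectation (\<lambda>\<omega>. f (X (s + h) \<omega>)) - expectation (\<lambda>\<omega>. f (X s \<omega>)) - h * expectation (\<lambda>\<omega>. g (X s \<omega>))\<bar> \<le> h * \<delta>"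
  proof (intro exI[of _ h0] conjI allI impI)
    fix s h :: real assume s: "s \<ge> 0" and h: "0 < h \<and> h < h0"
    have Tf: "continuous_on K (T h f)" using semigroup f h by (simp add: feller_semigroup_def)
    let ?q = "\<lambda>y. T h f y - f y - h * g y"
    have q: "continuous_on K ?q" by (intro continuous_intros Tf f g)
    have "expectation (\<lambda>\<omega>. ?q (X s \<omega>)) =
        expectation (\<lambda>\<omega>. T h f (X s \<omega>)) - expectation (\<lambda>\<omega>. f (X s \<omega>)) - h * expectation (\<lambda>\<omega>. g (X s \<omega>))"
      by (simp add: observable_integrable Tf f g s)
    moreover have "\<bar>?q y\<bar> \<le> h * \<delta>" if "y \<in> K" for y
    proof -
      have "?q y = h * ((T h f y - f y) / h - g y)" using h by (simp add: field_simps)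
      then show ?thesis using h h0(2)[of h y] that by (simp add: abs_mult)
    qed
    ultimately show "\<bar>expectation (\<lambda>\<omega>. f (X (s + h) \<omega>)) - expectation (\<lambda>\<omega>. f (X s \<omega>))
        - h * expectation (\<lambda>\<omega>. g (X s \<omega>))\<bar> \<le> h * \<delta>"
      using expectation_abs_le[OF q s, of "h * \<delta>"] markov_expectation[OF f s, of h] h by simp
  qed (rule h0)
qed

text \<open>
  The integrand of the discounted cost as a function on the product of the probability space and the
  time axis. The process is read at \<open>max 0 s\<close> because \<open>X s\<close> is a random variable only for \<open>s \<ge> 0\<close>; the
  indicator removes the negative times.
\<close>

definition discounted :: "real \<Rightarrow> ('a \<Rightarrow> real) \<Rightarrow> 'w \<times> real \<Rightarrow> real" where
  "discounted lam q = (\<lambda>(\<omega>, s). indicator {0..} s * (exp (- lam * s) * q (X (max 0 s) \<omega>)))"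

lemma discounted_measurable:
  assumes q: "continuous_on K q"
  shows "discounted lam q \<in> borel_measurable (M \<Otimes>\<^sub>M lborel)"
proof -
  have [measurable]: "(\<lambda>z. q (X (max 0 (snd z)) (fst z))) \<in> borel_measurable (M \<Otimes>\<^sub>M lborel)"
    by (intro borel_measurable_on_state_space q borel_measurable_continuous_paths
        process_measurable paths_continuous)
      (auto simp: space_pair_measure process_in)
  show ?thesis unfolding discounted_def split_beta by measurable
qed

lemma discounted_abs_le:
  assumes C: "\<And>y. y \<in> K \<Longrightarrow> \<bar>q y\<bar> \<le> C" and z: "z \<in> space (M \<Otimes>\<^sub>M lborel)"
  shows "\<bar>discounted lam q z\<bar> \<le> C * (indicator {0..} (snd z) * exp (- lam * snd z))"
proof -
  have "\<bar>q (X (max 0 (snd z)) (fst z))\<bar> \<le> C"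
    using z by (intro C process_in) (auto simp: space_pair_measure)
  then have "exp (- lam * snd z) * \<bar>q (X (max 0 (snd z)) (fst z))\<bar> \<le> exp (- lam * snd z) * C"
    by (intro mult_left_mono) auto
  then show ?thesis
    by (auto simp: discounted_def split_beta abs_mult mult.commute split: split_indicator)
qed

lemma discounted_dominant_integrable:
  fixes lam C :: real
  assumes lam: "lam > 0"
  shows "integrable (M \<Otimes>\<^sub>M lborel) (\<lambda>z. C * (indicator {0..} (snd z) * exp (- lam * snd z)))"
  by (rule Fubini_integrable) (use discount_integrable[OF lam] in \<open>auto simp: integrable_const\<close>)

lemma discounted_integrable:
  assumes q: "continuous_on K q" and lam: "lam > 0"
  shows "integrable (M \<Otimes>\<^sub>M lborel) (discounted lam q)"
proof -
  obtain C where C: "C > 0" "\<And>y. y \<in> K \<Longrightarrow> \<bar>q y\<bar> \<le> C"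
    using compact_continuous_bounded[OF compact q] by metis
  show ?thesis
    by (rule Bochner_Integration.integrable_bound[OF discounted_dominant_integrable[OF lam, of C]
          discounted_measurable[OF q]])
      (use C discounted_abs_le[of q C, OF C(2)] in \<open>fastforce intro!: AE_I2\<close>)
qed

text \<open>
  After Fubini's theorem the left-hand side is the integral over \<open>(0, \<infinity>)\<close> of
  \<open>e\<^bsup>-\<lambda>t\<^esup> (\<lambda> m(t) - n(t))\<close> with \<open>m(t) = E f(X\<^sub>t)\<close> and \<open>n(t) = E g(X\<^sub>t)\<close>. As \<open>m' = n\<close>, this is the
  derivative of \<open>- e\<^bsup>-\<lambda>t\<^esup> m(t)\<close>, which tends to \<open>0\<close> at infinity and is \<open>- f(x)\<close> at \<open>0\<close>.
\<close>

lemma resolvent_formula: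
  assumes gen: "semigroup_generator K T f g" and lam: "lam > 0"
  shows "(LINT z|(M \<Otimes>\<^sub>M lborel). discounted lam (\<lambda>y. lam * f y - g y) z) = f x"
proof -
  have f: "continuous_on K f" and g: "continuous_on K g"
    using gen by (auto simp: semigroup_generator_def)
  let ?q = "\<lambda>y. lam * f y - g y"
  have q: "continuous_on K ?q" by (intro continuous_intros f g)
  define m where "m t = expectation (\<lambda>\<omega>. f (X t \<omega>))" for t
  define n where "n t = expectation (\<lambda>\<omega>. g (X t \<omega>))" for t
  define \<phi> where "\<phi> t = exp (- lam * t) * (lam * m t - n t)" for t
  define \<Phi> where "\<Phi> t = - exp (- lam * t) * m t" for t
  have m_cont: "continuous_on {0..} m" and n_cont: "continuous_on {0..} n"
    unfolding m_def n_def by (intro expectation_continuous f g)+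
  have \<Phi>_cont: "continuous_on {0..} \<Phi>" and \<phi>_cont: "continuous_on {0..} \<phi>"
    unfolding \<Phi>_def \<phi>_def by (intro continuous_intros m_cont n_cont)+
  have slice: "expectation (\<lambda>\<omega>. discounted lam ?q (\<omega>, s)) = indicator {0..} s * \<phi> s" for s
  proof (cases "s \<ge> 0")
    case True
    then show ?thesis
      by (simp add: discounted_def \<phi>_def m_def n_def observable_integrable f g)
  qed (simp add: discounted_def)
  have int: "integrable lborel (\<lambda>s. indicator {0..} s * \<phi> s)"
    using integrable_snd[of "\<lambda>\<omega> s. discounted lam ?q (\<omega>, s)"] discounted_integrable[OF q lam]
    by (simp add: slice)
  \<comment> \<open>The fundamental theorem is for the open half-line; the point \<open>0\<close> has measure zero.\<close>
  have ae: "AE s in lborel. indicator {0..} s * \<phi> s = indicator {0<..} s * \<phi> s"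
    using AE_lborel_singleton[of 0] by eventually_elim (auto split: split_indicator)
  have "(LINT z|(M \<Otimes>\<^sub>M lborel). discounted lam ?q z) = (LINT s|lborel. indicator {0..} s * \<phi> s)"
    using integral_snd[of "\<lambda>\<omega> s. discounted lam ?q (\<omega>, s)"] discounted_integrable[OF q lam]
    by (simp add: slice)
  have meas: "(\<lambda>s. indicator {0<..} s * \<phi> s) \<in> borel_measurable lborel"
  proof -
    have "continuous_on {0<..} \<phi>" by (rule continuous_on_subset[OF \<phi>_cont]) auto
    from borel_measurable_continuous_on_indicator[OF _ this] show ?thesis by simp
  qed
  have "(LINT s|lborel. indicator {0..} s * \<phi> s) = (LINT s|lborel. indicator {0<..} s * \<phi> s)"
    by (rule integral_cong_AE[OF _ meas ae]) (use int in auto)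
  also have "\<dots> = (LBINT s=ereal 0..\<infinity>. \<phi> s)"
    by (simp add: interval_integral_to_infinity_eq set_lebesgue_integral_def)
  also have "\<dots> = 0 - (- f x)"
  proof (rule interval_integral_FTC_integrable[where F = \<Phi>])
    fix t assume "ereal 0 < ereal t"
    then have t: "t > 0" by simp
    show "isCont \<phi> t"
      using continuous_on_subset[OF \<phi>_cont, of "{0<..}"] t
      by (simp add: continuous_on_eq_continuous_at subset_eq)
    have "(\<Phi> has_real_derivative \<phi> t) (at t)"
      unfolding \<Phi>_def[abs_def] \<phi>_def m_def[abs_def] n_def
      by (rule derivative_eq_intros expectation_DERIV[OF gen t] refl)+ (simp add: algebra_simps)
    then show "(\<Phi> has_vector_derivative \<phi> t) (at t)"
      by (simp add: has_real_derivative_iff_has_vector_derivative)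
  next
    have "integrable lborel (\<lambda>s. indicator {0<..} s * \<phi> s)"
      using integrable_cong_AE_imp[OF int meas] ae by auto
    then show "set_integrable lborel (einterval (ereal 0) \<infinity>) \<phi>"
      by (simp add: set_integrable_def)
  next
    have "(\<Phi> \<longlongrightarrow> \<Phi> 0) (at_right 0)"
      using \<Phi>_cont by (auto simp: continuous_on intro: tendsto_within_subset[of _ _ _ "{0..}"])
    also have "\<Phi> 0 = - f x" by (simp add: \<Phi>_def m_def expectation_start[OF f])
    finally show "((\<Phi> \<circ> real_of_ereal) \<longlongrightarrow> - f x) (at_right (ereal 0))"
      by (simp add: ereal_tendsto_simps1)
  next
    obtain C where C: "\<And>y. y \<in> K \<Longrightarrow> \<bar>f y\<bar> \<le> C"
      using compact_continuous_bounded[OF compact f] by metis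
    have "(\<Phi> \<longlongrightarrow> 0) at_top"
    proof (rule Lim_null_comparison)
      have "\<bar>m t\<bar> \<le> C" if "t \<ge> 0" for t
        unfolding m_def using that by (intro expectation_abs_le f C)
      then show "\<forall>\<^sub>F t in at_top. norm (\<Phi> t) \<le> C * exp (- lam * t)"
        by (intro eventually_mono[OF eventually_ge_at_top[of 0]]) (simp add: \<Phi>_def abs_mult)
      have "((\<lambda>t. exp (- (lam * t))) \<longlongrightarrow> 0) at_top"
        using lam by (intro filterlim_compose[OF exp_at_bot] filterlim_uminus_at_bot_at_top[THEN filterlim_compose]
            filterlim_tendsto_pos_mult_at_top[OF tendsto_const] filterlim_ident)
      from tendsto_mult_right_zero[OF this, of C]
      show "((\<lambda>t. C * exp (- lam * t)) \<longlongrightarrow> 0) at_top" by simp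
    qed
    then show "((\<Phi> \<circ> real_of_ereal) \<longlongrightarrow> 0) (at_left \<infinity>)"
      by (simp add: ereal_tendsto_simps1)
  qed simp
  finally show ?thesis
    using \<open>(LINT z|(M \<Otimes>\<^sub>M lborel). discounted lam ?q z) = (LINT s|lborel. indicator {0..} s * \<phi> s)\<close> by simp
qed

text \<open>
  This extends the resolvent formula to right-hand sides \<open>h\<close> that are only bounded pointwise limits of
  continuous ones. It is what makes costs accessible that jump at the vertices: \<open>ux\<close> may be the value
  of a function outside the domain of the generator.
\<close>

lemma resolvent_formula_limit:
  assumes gen: "\<And>n. semigroup_generator K T (f n) (g n)" and lam: "lam > 0"
    and f_lim: "(\<lambda>n. f n x) \<longlonglongrightarrow> ux"
    and h_lim: "\<And>y. y \<in> K \<Longrightarrow> (\<lambda>n. lam * f n y - g n y) \<longlonglongrightarrow> h y"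
    and bound: "\<And>n y. y \<in> K \<Longrightarrow> \<bar>lam * f n y - g n y\<bar> \<le> C"
  shows "(LINT \<omega>|M. (LINT s:{0..}|lborel. exp (- lam * s) * h (X s \<omega>))) = ux"
proof -
  let ?P = "M \<Otimes>\<^sub>M (lborel :: real measure)"
  let ?q = "\<lambda>n y. lam * f n y - g n y"
  have q: "continuous_on K (?q n)" for n
    using gen[of n] by (auto simp: semigroup_generator_def intro!: continuous_intros)
  have lim: "(\<lambda>n. discounted lam (?q n) z) \<longlonglongrightarrow> discounted lam h z" if "z \<in> space ?P" for z
    unfolding discounted_def split_beta
    using that by (intro tendsto_intros h_lim process_in) (auto simp: space_pair_measure)
  have meas: "discounted lam h \<in> borel_measurable ?P"
    by (rule borel_measurable_LIMSEQ_metric[OF discounted_measurable[OF q] lim])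
  note dom = discounted_dominant_integrable[OF lam, of C]
  have bd: "AE z in ?P. norm (discounted lam (?q n) z) \<le> C * (indicator {0..} (snd z) * exp (- lam * snd z))" for n
    using discounted_abs_le[OF bound] by (intro AE_I2) auto
  have ae: "AE z in ?P. (\<lambda>n. discounted lam (?q n) z) \<longlonglongrightarrow> discounted lam h z"
    using lim by (intro AE_I2)
  have "integrable ?P (discounted lam h)"
    by (rule integrable_dominated_convergence[OF meas discounted_measurable[OF q] dom ae bd])
  then have fub: "(LINT \<omega>|M. LINT s|lborel. discounted lam h (\<omega>, s)) = (LINT z|?P. discounted lam h z)"
    by (rule integral_fst')
  have "(\<lambda>n. LINT z|?P. discounted lam (?q n) z) \<longlonglongrightarrow> (LINT z|?P. discounted lam h z)"
    by (rule integral_dominated_convergence[OF meas discounted_measurable[OF q] dom ae bd])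
  then have "(LINT z|?P. discounted lam h z) = ux"
    using f_lim by (simp add: resolvent_formula[OF gen lam] LIMSEQ_unique)
  moreover have "(LINT s|lborel. discounted lam h (\<omega>, s)) = (LINT s:{0..}|lborel. exp (- lam * s) * h (X s \<omega>))" for \<omega>
    unfolding set_lebesgue_integral_def discounted_def
    by (intro Bochner_Integration.integral_cong) (auto split: split_indicator)
  ultimately show ?thesis using fub by simp
qed

end

section \<open>Geometry of a network\<close>

lemma edge_ends:
  assumes "is_network N" "\<alpha> \<in> edges N"
  shows "src N \<alpha> \<in> verts N" "tgt N \<alpha> \<in> verts N" "len N \<alpha> > 0"
    "src N \<alpha> \<in> edge N \<alpha>" "tgt N \<alpha> \<in> edge N \<alpha>"
proof -
  have "(src N \<alpha>, tgt N \<alpha>) \<in> pairs N \<or> (tgt N \<alpha>, src N \<alpha>) \<in> pairs N"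
    "pairs N \<subseteq> verts N \<times> verts N" "\<forall>v. (v, v) \<notin> pairs N"
    using assms by (auto simp: is_network_def)
  then show "src N \<alpha> \<in> verts N" "tgt N \<alpha> \<in> verts N" "len N \<alpha> > 0"
    by (auto simp: len_def)
qed (auto simp: edge_def)

lemma coord_ends: "coord N \<alpha> (src N \<alpha>) = 0" "coord N \<alpha> (tgt N \<alpha>) = len N \<alpha>"
  by (simp_all add: coord_def len_def)

lemma coord_range:
  assumes "x \<in> edge N \<alpha>"
  shows "coord N \<alpha> x \<in> {0..len N \<alpha>}"
  using segment_bound(1)[of x "src N \<alpha>" "tgt N \<alpha>"] assms
  by (simp add: coord_def len_def edge_def dist_norm norm_minus_commute)

lemma param_in_edge:
  assumes "len N \<alpha> > 0" "s \<in> {0..len N \<alpha>}"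
  shows "param N \<alpha> s \<in> edge N \<alpha>"
  unfolding edge_def closed_segment_def
  by (simp, rule exI[of _ "s / len N \<alpha>"])
    (use assms in \<open>auto simp: param_def algebra_simps divide_inverse[symmetric]\<close>)

lemma param_continuous: "continuous_on S (param N \<alpha>)"
  unfolding param_def[abs_def] by (intro continuous_intros)

lemma coord_continuous: "continuous_on S (coord N \<alpha>)"
  unfolding coord_def[abs_def] by (intro continuous_intros)

text \<open>
  Gluing along the network is possible because edges meet only at common end points.
\<close>

lemma common_point_is_end:
  assumes N: "is_network N" and ab: "\<alpha> \<in> edges N" "\<beta> \<in> edges N" "\<alpha> \<noteq> \<beta>"
    and x: "x \<in> edge N \<alpha>" "x \<in> edge N \<beta>"
  shows "x \<in> {src N \<alpha>, tgt N \<alpha>} \<inter> {src N \<beta>, tgt N \<beta>}"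
proof -
  let ?I = "{src N \<alpha>, tgt N \<alpha>} \<inter> {src N \<beta>, tgt N \<beta>}"
  have "\<forall>\<alpha>\<in>edges N. \<forall>\<beta>\<in>edges N. \<alpha> \<noteq> \<beta> \<longrightarrow>
      (\<forall>v. v \<in> {src N \<alpha>, tgt N \<alpha>} \<inter> {src N \<beta>, tgt N \<beta>} \<longrightarrow> edge N \<alpha> \<inter> edge N \<beta> = {v}) \<and>
      ({src N \<alpha>, tgt N \<alpha>} \<inter> {src N \<beta>, tgt N \<beta>} = {} \<longrightarrow> edge N \<alpha> \<inter> edge N \<beta> = {})"
    using N unfolding is_network_def by (elim conjE)
  note this[rule_format (no_asm), OF ab]
  note * = conjunct1[OF this] conjunct2[OF this]
  have "edge N \<alpha> \<inter> edge N \<beta> \<noteq> {}" using x by (metis Int_iff empty_iff)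
  then have "?I \<noteq> {}" using mp[OF *(2)] by (rule contrapos_nn)
  then obtain v where v: "v \<in> ?I" by (metis ex_in_conv)
  then have "edge N \<alpha> \<inter> edge N \<beta> = {v}" using *(1) by (metis (lifting))
  then have "x = v" using x by (metis IntI singletonD)
  then show ?thesis using v by (simp only:)
qed

text \<open>
  There are no T-junctions: a vertex is an end point of some edge, and this edge can meet another one
  only at an end point of the latter.
\<close>

lemma vertex_on_edge_is_end:
  assumes N: "is_network N" and a: "\<alpha> \<in> edges N" and v: "v \<in> verts N" "v \<in> edge N \<alpha>"
  shows "v = src N \<alpha> \<or> v = tgt N \<alpha>"
proof -
  have "\<forall>v\<in>verts N. \<exists>w. (v, w) \<in> pairs N \<or> (w, v) \<in> pairs N"
    using N by (simp add: is_network_def)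
  then obtain w where "(v, w) \<in> pairs N \<or> (w, v) \<in> pairs N" using v by blast
  then obtain \<beta> where b: "\<beta> \<in> edges N" "edge N \<beta> = closed_segment v w"
    using N closed_segment_commute[of v w] by (auto simp: is_network_def)
  then have e: "{src N \<beta>, tgt N \<beta>} = {v, w}" by (simp add: edge_def)
  show ?thesis
  proof (cases "\<alpha> = \<beta>")
    case True
    then show ?thesis using e by (auto simp: doubleton_eq_iff)
  next
    case False
    then show ?thesis using common_point_is_end[OF N a b(1) False v(2)] b by auto
  qed
qed

lemma vertex_in_net:
  assumes N: "is_network N" and v: "v \<in> verts N"
  shows "v \<in> net N"
proof -
  have "\<forall>v\<in>verts N. \<exists>w. (v, w) \<in> pairs N \<or> (w, v) \<in> pairs N"
    "\<forall>(v, w)\<in>pairs N. \<exists>\<alpha>\<in>edges N. edge N \<alpha> = closed_segment v w"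
    using N by (simp_all add: is_network_def)
  then obtain w \<alpha> where "\<alpha> \<in> edges N" "edge N \<alpha> = closed_segment v w \<or> edge N \<alpha> = closed_segment w v"
    using v by blast
  then show ?thesis by (auto simp: net_def)
qed

lemma interior_point_iff:
  assumes N: "is_network N" and a: "\<alpha> \<in> edges N" and x: "x \<in> edge N \<alpha>"
  shows "x \<notin> verts N \<longleftrightarrow> coord N \<alpha> x \<in> {0<..<len N \<alpha>}"
proof -
  have "x = src N \<alpha> \<longleftrightarrow> coord N \<alpha> x = 0" "x = tgt N \<alpha> \<longleftrightarrow> coord N \<alpha> x = len N \<alpha>"
    using param_coord[OF x edge_ends(3)[OF N a]] edge_ends(3)[OF N a]
      param_coord[OF edge_ends(5)[OF N a] edge_ends(3)[OF N a]]
    by (auto simp: coord_ends) (simp add: coord_def)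
  moreover have "x \<in> verts N \<longleftrightarrow> x = src N \<alpha> \<or> x = tgt N \<alpha>"
    using vertex_on_edge_is_end[OF N a _ x] edge_ends[OF N a] by blast
  ultimately show ?thesis using coord_range[OF x] by auto
qed

lemma interior_edge_unique:
  assumes "is_network N" "\<alpha> \<in> edges N" "\<beta> \<in> edges N" "x \<in> edge N \<alpha>" "x \<in> edge N \<beta>" "x \<notin> verts N"
  shows "\<alpha> = \<beta>"
  using common_point_is_end[of N \<alpha> \<beta> x] edge_ends[of N \<alpha>] assms by blast

lemma param_interior:
  assumes N: "is_network N" and a: "\<alpha> \<in> edges N" and s: "s \<in> {0<..<len N \<alpha>}"
  shows "param N \<alpha> s \<in> edge N \<alpha>" "param N \<alpha> s \<notin> verts N"
proof -
  show *: "param N \<alpha> s \<in> edge N \<alpha>" using s edge_ends(3)[OF N a] by (intro param_in_edge) auto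
  show "param N \<alpha> s \<notin> verts N"
    using s edge_ends(3)[OF N a] by (simp add: interior_point_iff[OF N a *] coord_param)
qed

lemma net_compact:
  assumes "is_network N"
  shows "compact (net N)"
  using assms unfolding net_def edge_def is_network_def by (intro compact_UN) auto

section \<open>Gluing functions given edge by edge\<close>

text \<open>
  Off the vertices the choice is forced; at a vertex it is one of the edges that end there.
\<close>

definition chosen_edge :: "('a::euclidean_space, 'i) network \<Rightarrow> 'a \<Rightarrow> 'i" where
  "chosen_edge N x = (SOME \<alpha>. \<alpha> \<in> edges N \<and> x \<in> edge N \<alpha>)"

lemma chosen_edge:
  assumes "x \<in> net N"
  shows "chosen_edge N x \<in> edges N" "x \<in> edge N (chosen_edge N x)"
  using someI_ex[of "\<lambda>\<alpha>. \<alpha> \<in> edges N \<and> x \<in> edge N \<alpha>"] assms by (auto simp: chosen_edge_def net_def)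

lemma chosen_edge_interior:
  assumes "is_network N" "\<alpha> \<in> edges N" "x \<in> edge N \<alpha>" "x \<notin> verts N"
  shows "chosen_edge N x = \<alpha>"
proof -
  have "x \<in> net N" using assms by (auto simp: net_def)
  from chosen_edge[OF this] show ?thesis using interior_edge_unique assms by metis
qed

definition glue :: "('a::euclidean_space, 'i) network \<Rightarrow> ('i \<Rightarrow> real \<Rightarrow> real) \<Rightarrow> 'a \<Rightarrow> real" where
  "glue N k x = k (chosen_edge N x) (coord N (chosen_edge N x) x)"

text \<open>
  The compatibility of the functions \<open>k \<alpha>\<close> is that their end values come from one function \<open>c\<close> on the
  vertices; then the arbitrary choice of an edge at a vertex does not matter.
\<close>

lemma glue_eq:
  assumes N: "is_network N"
    and ends: "\<And>\<alpha>. \<alpha> \<in> edges N \<Longrightarrow> k \<alpha> 0 = c (src N \<alpha>) \<and> k \<alpha> (len N \<alpha>) = c (tgt N \<alpha>)"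
    and a: "\<alpha> \<in> edges N" and x: "x \<in> edge N \<alpha>"
  shows "glue N k x = k \<alpha> (coord N \<alpha> x)"
proof (cases "chosen_edge N x = \<alpha>")
  case False
  have net: "x \<in> net N" using a x by (auto simp: net_def)
  have at_end: "k \<beta> (coord N \<beta> x) = c x" if "\<beta> \<in> edges N" "x \<in> {src N \<beta>, tgt N \<beta>}" for \<beta>
    using that ends by (auto simp: coord_ends)
  show ?thesis
    using common_point_is_end[OF N chosen_edge(1)[OF net] a False chosen_edge(2)[OF net] x] at_end a chosen_edge(1)[OF net]
    by (simp add: glue_def)
qed (simp add: glue_def)

lemma glue_continuous:
  assumes N: "is_network N"
    and ends: "\<And>\<alpha>. \<alpha> \<in> edges N \<Longrightarrow> k \<alpha> 0 = c (src N \<alpha>) \<and> k \<alpha> (len N \<alpha>) = c (tgt N \<alpha>)"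
    and cont: "\<And>\<alpha>. \<alpha> \<in> edges N \<Longrightarrow> continuous_on {0..len N \<alpha>} (k \<alpha>)"
  shows "continuous_on (net N) (glue N k)"
  unfolding net_def
proof (rule continuous_on_closed_Union)
  show "finite (edges N)" using N by (simp add: is_network_def)
  show "closed (edge N \<alpha>)" for \<alpha> by (simp add: edge_def)
  fix \<alpha> assume a: "\<alpha> \<in> edges N"
  have "continuous_on (edge N \<alpha>) (\<lambda>x. k \<alpha> (coord N \<alpha> x))"
    by (rule continuous_on_compose2[OF cont[OF a] coord_continuous]) (rule image_subsetI, rule coord_range)
  then show "continuous_on (edge N \<alpha>) (glue N k)"
    by (rule continuous_on_eq) (use glue_eq[OF N ends a] in auto)
qed

section \<open>Derivatives along the edges\<close>

lemma d1_eq: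
  assumes N: "is_network N" and a: "\<alpha> \<in> edges N" and x: "x \<in> edge N \<alpha>"
    and D: "\<And>s. s \<in> {0..len N \<alpha>} \<Longrightarrow>
      ((u \<circ> param N \<alpha>) has_real_derivative u1 s) (at s within {0..len N \<alpha>})"
  shows "d1 N \<alpha> u x = u1 (coord N \<alpha> x)"
  unfolding d1_def
  using D[OF coord_range[OF x]] edge_ends(3)[OF N a] coord_range[OF x]
    vector_derivative_within_cbox[of 0 "len N \<alpha>" "coord N \<alpha> x" "u \<circ> param N \<alpha>" "u1 (coord N \<alpha> x)"]
  by (simp add: has_real_derivative_iff_has_vector_derivative)

lemma d2_eq:
  assumes N: "is_network N" and a: "\<alpha> \<in> edges N" and x: "x \<in> edge N \<alpha>"
    and D1: "\<And>s. s \<in> {0..len N \<alpha>} \<Longrightarrow>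
      ((u \<circ> param N \<alpha>) has_real_derivative u1 s) (at s within {0..len N \<alpha>})"
    and D2: "\<And>s. s \<in> {0..len N \<alpha>} \<Longrightarrow> (u1 has_real_derivative u2 s) (at s within {0..len N \<alpha>})"
  shows "d2 N \<alpha> u x = u2 (coord N \<alpha> x)"
  unfolding d2_def
proof (rule d1_eq[OF N a x])
  fix s assume s: "s \<in> {0..len N \<alpha>}"
  have eq: "(d1 N \<alpha> u \<circ> param N \<alpha>) t = u1 t" if "t \<in> {0..len N \<alpha>}" for t
    using that d1_eq[OF N a param_in_edge[OF edge_ends(3)[OF N a] that] D1] edge_ends(3)[OF N a]
    by (simp add: coord_param)
  show "((d1 N \<alpha> u \<circ> param N \<alpha>) has_real_derivative u2 s) (at s within {0..len N \<alpha>})"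
    by (rule has_field_derivative_transform_within[OF D2[OF s] zero_less_one s]) (use eq in auto)
qed

lemma Ck_net_2E:
  assumes "Ck_net 2 N u"
  obtains u1 u2 where
    "\<And>\<alpha> s. \<alpha> \<in> edges N \<Longrightarrow> s \<in> {0..len N \<alpha>} \<Longrightarrow>
      ((u \<circ> param N \<alpha>) has_real_derivative u1 \<alpha> s) (at s within {0..len N \<alpha>})"
    "\<And>\<alpha> s. \<alpha> \<in> edges N \<Longrightarrow> s \<in> {0..len N \<alpha>} \<Longrightarrow>
      (u1 \<alpha> has_real_derivative u2 \<alpha> s) (at s within {0..len N \<alpha>})"
    "\<And>\<alpha>. \<alpha> \<in> edges N \<Longrightarrow> continuous_on {0..len N \<alpha>} (u1 \<alpha>)"
    "\<And>\<alpha>. \<alpha> \<in> edges N \<Longrightarrow> continuous_on {0..len N \<alpha>} (u2 \<alpha>)"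
proof -
  have "\<forall>\<alpha>\<in>edges N. \<exists>v w. (\<forall>s\<in>{0..len N \<alpha>}. ((u \<circ> param N \<alpha>) has_real_derivative v s) (at s within {0..len N \<alpha>})) \<and>
      (\<forall>s\<in>{0..len N \<alpha>}. (v has_real_derivative w s) (at s within {0..len N \<alpha>})) \<and>
      continuous_on {0..len N \<alpha>} w"
    using assms by (simp add: Ck_net_def numeral_2_eq_2)
  then obtain u1 u2 where *: "\<forall>\<alpha>\<in>edges N. (\<forall>s\<in>{0..len N \<alpha>}. ((u \<circ> param N \<alpha>) has_real_derivative u1 \<alpha> s) (at s within {0..len N \<alpha>})) \<and>
      (\<forall>s\<in>{0..len N \<alpha>}. (u1 \<alpha> has_real_derivative u2 \<alpha> s) (at s within {0..len N \<alpha>})) \<and>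
      continuous_on {0..len N \<alpha>} (u2 \<alpha>)"
    by metis
  have D: "((u \<circ> param N \<alpha>) has_real_derivative u1 \<alpha> s) (at s within {0..len N \<alpha>})"
    "(u1 \<alpha> has_real_derivative u2 \<alpha> s) (at s within {0..len N \<alpha>})"
    if "\<alpha> \<in> edges N" "s \<in> {0..len N \<alpha>}" for \<alpha> s
    using * that by blast+
  show ?thesis
    by (rule that[of u1 u2, OF D DERIV_continuous_on[OF D(2)]]) (use * in auto)
qed

section \<open>Corner corrections\<close>

text \<open>
  The function \<open>t\<^sup>2 (1 - t)\<^sup>3 / 2\<close> on \<open>[0, 1]\<close>, continued by \<open>0\<close>. It has value and slope \<open>0\<close> and second
  derivative \<open>1\<close> at \<open>t = 0\<close>; the third power makes the continuation at \<open>t = 1\<close> twice continuously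
  differentiable.
\<close>

definition bump :: "real \<Rightarrow> real" where
  "bump t = t\<^sup>2 * max 0 (1 - t) ^ 3 / 2"

definition bump1 :: "real \<Rightarrow> real" where
  "bump1 t = t * max 0 (1 - t) ^ 3 - 3 / 2 * t\<^sup>2 * max 0 (1 - t) ^ 2"

definition bump2 :: "real \<Rightarrow> real" where
  "bump2 t = max 0 (1 - t) ^ 3 - 6 * t * max 0 (1 - t) ^ 2 + 3 * t\<^sup>2 * max 0 (1 - t)"

lemma DERIV_max_power:
  fixes x :: real
  assumes "k \<ge> 1"
  shows "((\<lambda>x. max 0 x ^ Suc k) has_real_derivative real (Suc k) * max 0 x ^ k) (at x)"
proof -
  have "((\<lambda>x. if x \<in> {..0} then 0 else x ^ Suc k) has_vector_derivative
      (if x \<in> {..0} then 0 else real (Suc k) * x ^ k)) (at x within UNIV)"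
  proof (rule has_vector_derivative_If_within_closures[where T = "{0..}"])
    show "((\<lambda>x. x ^ Suc k) has_vector_derivative real (Suc k) * x ^ k)
        (at x within {0..} \<union> closure {..0} \<inter> closure {0..})"
      unfolding has_real_derivative_iff_has_vector_derivative[symmetric]
      by (rule derivative_eq_intros refl)+ (use assms in \<open>cases k; auto simp: algebra_simps\<close>)
  qed (use assms in auto)
  moreover have "(\<lambda>x. max 0 x ^ Suc k) = (\<lambda>x::real. if x \<in> {..0} then 0 else x ^ Suc k)"
    by (auto simp: max_def)
  moreover have "real (Suc k) * max 0 x ^ k = (if x \<in> {..0} then 0 else real (Suc k) * x ^ k)"
    using assms by (auto simp: max_def)
  ultimately show ?thesis by (simp add: has_real_derivative_iff_has_vector_derivative)
qed

lemma DERIV_cut_power: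
  fixes t :: real
  assumes "k \<ge> 1"
  shows "((\<lambda>t. max 0 (1 - t) ^ Suc k) has_real_derivative - real (Suc k) * max 0 (1 - t) ^ k) (at t)"
proof -
  have "((\<lambda>t. 1 - t) has_real_derivative - 1) (at t)" by (auto intro!: derivative_eq_intros)
  from DERIV_chain2[where f = "\<lambda>x. max 0 x ^ Suc k", OF DERIV_max_power[OF assms] this]
  show ?thesis by (simp add: algebra_simps)
qed

lemma DERIV_bump: "(bump has_real_derivative bump1 t) (at t)"
proof -
  have 3: "((\<lambda>t. max 0 (1 - t) ^ 3) has_real_derivative - 3 * (max 0 (1 - t))\<^sup>2) (at t)"
    using DERIV_cut_power[of 2 t] by (simp add: numeral_3_eq_3)
  show ?thesis
    unfolding bump_def[abs_def] bump1_def
    by (rule 3 derivative_eq_intros refl)+ (simp_all add: field_simps power2_eq_square)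
qed

lemma DERIV_bump1: "(bump1 has_real_derivative bump2 t) (at t)"
proof -
  have 3: "((\<lambda>t. max 0 (1 - t) ^ 3) has_real_derivative - 3 * (max 0 (1 - t))\<^sup>2) (at t)"
    using DERIV_cut_power[of 2 t] by (simp add: numeral_3_eq_3)
  have 2: "((\<lambda>t. (max 0 (1 - t))\<^sup>2) has_real_derivative - 2 * max 0 (1 - t)) (at t)"
    using DERIV_cut_power[of 1 t] by (simp add: numeral_2_eq_2)
  show ?thesis
    unfolding bump1_def[abs_def] bump2_def
    by (rule 2 3 derivative_eq_intros refl)+ (simp add: field_simps power2_eq_square)
qed

lemma bump_zero: "bump 0 = 0" "bump1 0 = 0" "bump2 0 = 1"
  by (simp_all add: bump_def bump1_def bump2_def)

lemma bump_vanishes: "t \<ge> 1 \<Longrightarrow> bump t = 0 \<and> bump1 t = 0 \<and> bump2 t = 0"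
  by (simp add: bump_def bump1_def bump2_def)

lemma bump_bounds:
  assumes "t \<ge> 0"
  shows "\<bar>bump t\<bar> \<le> 10" "\<bar>bump1 t\<bar> \<le> 10" "\<bar>bump2 t\<bar> \<le> 10"
proof -
  define m where "m = max 0 (1 - t)"
  have "\<bar>bump t\<bar> \<le> 10 \<and> \<bar>bump1 t\<bar> \<le> 10 \<and> \<bar>bump2 t\<bar> \<le> 10"
  proof (cases "t \<ge> 1")
    case False
    then have t: "0 \<le> t" "t \<le> 1" and m: "0 \<le> m" "m \<le> 1" using assms by (auto simp: m_def)
    have prod: "0 \<le> x * y \<and> x * y \<le> 1" if "0 \<le> x" "x \<le> 1" "0 \<le> y" "y \<le> 1" for x y :: real
      using that by (auto simp: mult_le_one)
    have pw: "0 \<le> x ^ k \<and> x ^ k \<le> 1" if "0 \<le> x" "x \<le> 1" for x :: real and k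
      using that by (auto simp: power_le_one)
    have "0 \<le> t\<^sup>2 * m ^ 3 \<and> t\<^sup>2 * m ^ 3 \<le> 1" "0 \<le> t * m ^ 3 \<and> t * m ^ 3 \<le> 1"
      "0 \<le> t\<^sup>2 * m\<^sup>2 \<and> t\<^sup>2 * m\<^sup>2 \<le> 1" "0 \<le> m ^ 3 \<and> m ^ 3 \<le> 1" "0 \<le> t * m\<^sup>2 \<and> t * m\<^sup>2 \<le> 1"
      "0 \<le> t\<^sup>2 * m \<and> t\<^sup>2 * m \<le> 1"
      using t m pw by (auto intro!: prod[THEN conjunct1] prod[THEN conjunct2])
    then show ?thesis
      unfolding bump_def bump1_def bump2_def m_def[symmetric] mult.assoc abs_le_iff by (intro conjI) linarith+
  qed (use bump_vanishes in auto)
  then show "\<bar>bump t\<bar> \<le> 10" "\<bar>bump1 t\<bar> \<le> 10" "\<bar>bump2 t\<bar> \<le> 10" by auto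
qed

text \<open>
  With \<open>\<epsilon> = L / (n + 1)\<close>, a bump \<open>\<epsilon>\<^sup>2 bump (s / \<epsilon>)\<close> has bounded second derivative, supported in
  \<open>[0, \<epsilon>]\<close> and equal to \<open>1\<close> at \<open>0\<close>. So the correction below changes the second derivative at the two
  ends of \<open>[0, L]\<close> by prescribed amounts \<open>A\<close> and \<open>B\<close>, leaves values and slopes there untouched, and
  vanishes at each inner point as soon as \<open>n\<close> is large. The width \<open>\<epsilon>\<close> never exceeds \<open>L\<close>, hence the bump
  at one end does not reach the other end.
\<close>

definition corner :: "real \<Rightarrow> real \<Rightarrow> real \<Rightarrow> nat \<Rightarrow> real \<Rightarrow> real" where
  "corner A B L n s = (let \<epsilon> = L / real (Suc n) in A * \<epsilon>\<^sup>2 * bump (s / \<epsilon>) + B * \<epsilon>\<^sup>2 * bump ((L - s) / \<epsilon>))"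

definition corner1 :: "real \<Rightarrow> real \<Rightarrow> real \<Rightarrow> nat \<Rightarrow> real \<Rightarrow> real" where
  "corner1 A B L n s = (let \<epsilon> = L / real (Suc n) in A * \<epsilon> * bump1 (s / \<epsilon>) - B * \<epsilon> * bump1 ((L - s) / \<epsilon>))"

definition corner2 :: "real \<Rightarrow> real \<Rightarrow> real \<Rightarrow> nat \<Rightarrow> real \<Rightarrow> real" where
  "corner2 A B L n s = (let \<epsilon> = L / real (Suc n) in A * bump2 (s / \<epsilon>) + B * bump2 ((L - s) / \<epsilon>))"

lemma DERIV_corner:
  assumes "L > 0"
  shows "(corner A B L n has_real_derivative corner1 A B L n s) (at s)"
    "(corner1 A B L n has_real_derivative corner2 A B L n s) (at s)"
proof -
  define \<epsilon> where "\<epsilon> = L / real (Suc n)"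
  have e: "\<epsilon> > 0" using assms by (simp add: \<epsilon>_def)
  have left: "((\<lambda>s. s / \<epsilon>) has_real_derivative 1 / \<epsilon>) (at s)"
    and right: "((\<lambda>s. (L - s) / \<epsilon>) has_real_derivative - 1 / \<epsilon>) (at s)"
    using e by (auto intro!: derivative_eq_intros)
  note D = DERIV_chain2[OF DERIV_bump left] DERIV_chain2[OF DERIV_bump right]
  note D1 = DERIV_chain2[OF DERIV_bump1 left] DERIV_chain2[OF DERIV_bump1 right]
  show "(corner A B L n has_real_derivative corner1 A B L n s) (at s)"
    unfolding corner_def[abs_def] corner1_def Let_def \<epsilon>_def[symmetric]
    by (rule derivative_eq_intros D refl)+ (use e in \<open>simp add: field_simps power2_eq_square\<close>)
  show "(corner1 A B L n has_real_derivative corner2 A B L n s) (at s)"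
    unfolding corner1_def[abs_def] corner2_def Let_def \<epsilon>_def[symmetric]
    by (rule derivative_eq_intros D1 refl)+ (use e in \<open>simp add: field_simps power2_eq_square\<close>)
qed

lemma corner2_continuous: "L > 0 \<Longrightarrow> continuous_on S (corner2 A B L n)"
  unfolding corner2_def[abs_def] bump2_def[abs_def] Let_def by (intro continuous_intros) auto

lemma corner_ends:
  assumes "L > 0"
  shows "corner A B L n 0 = 0" "corner A B L n L = 0" "corner1 A B L n 0 = 0" "corner1 A B L n L = 0"
    "corner2 A B L n 0 = A" "corner2 A B L n L = B"
proof -
  have "L / (L / real (Suc n)) \<ge> 1" using assms by simp
  from bump_vanishes[OF this]
  show "corner A B L n 0 = 0" "corner A B L n L = 0" "corner1 A B L n 0 = 0" "corner1 A B L n L = 0"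
    "corner2 A B L n 0 = A" "corner2 A B L n L = B"
    by (simp_all add: corner_def corner1_def corner2_def Let_def bump_zero del: divide_divide_eq_right of_nat_Suc)
qed

lemma corner_eventually_zero:
  assumes s: "0 < s" "s < L"
  shows "\<forall>\<^sub>F n in sequentially. corner A B L n s = 0 \<and> corner1 A B L n s = 0 \<and> corner2 A B L n s = 0"
proof -
  have "(\<lambda>n. L * inverse (real (Suc n))) \<longlonglongrightarrow> L * 0"
    by (intro tendsto_mult tendsto_const LIMSEQ_inverse_real_of_nat)
  then have "\<forall>\<^sub>F n in sequentially. L * inverse (real (Suc n)) < min s (L - s)"
    by (rule order_tendstoD(2)) (use s in auto)
  then show ?thesis
  proof eventually_elim
    case (elim n)
    define \<epsilon> where "\<epsilon> = L / real (Suc n)"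
    have "\<epsilon> > 0" "\<epsilon> < s" "\<epsilon> < L - s" using elim s by (auto simp: \<epsilon>_def divide_inverse)
    then have "s / \<epsilon> \<ge> 1" "(L - s) / \<epsilon> \<ge> 1" by simp_all
    then show ?case
      unfolding corner_def corner1_def corner2_def Let_def \<epsilon>_def[symmetric] by (simp add: bump_vanishes)
  qed
qed

lemma corner_bounds:
  assumes s: "s \<in> {0..L}" and L: "L > 0"
  shows "\<bar>corner A B L n s\<bar> \<le> 10 * (\<bar>A\<bar> + \<bar>B\<bar>) * L\<^sup>2" "\<bar>corner1 A B L n s\<bar> \<le> 10 * (\<bar>A\<bar> + \<bar>B\<bar>) * L"
    "\<bar>corner2 A B L n s\<bar> \<le> 10 * (\<bar>A\<bar> + \<bar>B\<bar>)"
proof -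
  define \<epsilon> where "\<epsilon> = L / real (Suc n)"
  have e: "\<epsilon> > 0" "\<epsilon> \<le> L" using L by (auto simp: \<epsilon>_def field_simps)
  have pos: "s / \<epsilon> \<ge> 0" "(L - s) / \<epsilon> \<ge> 0" using s e by auto
  have le: "\<bar>P * c * p + Q * c * q\<bar> \<le> 10 * (\<bar>A\<bar> + \<bar>B\<bar>) * d"
    if "\<bar>p\<bar> \<le> 10" "\<bar>q\<bar> \<le> 10" "\<bar>P\<bar> = \<bar>A\<bar>" "\<bar>Q\<bar> = \<bar>B\<bar>" "0 \<le> c" "c \<le> d" for P Q c d p q :: real
  proof -
    have "\<bar>P * c * p\<bar> \<le> \<bar>A\<bar> * d * 10" "\<bar>Q * c * q\<bar> \<le> \<bar>B\<bar> * d * 10"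
      unfolding abs_mult using that by (auto intro!: mult_mono)
    then show ?thesis by (simp add: algebra_simps abs_le_iff)
  qed
  have "\<epsilon>\<^sup>2 \<le> L\<^sup>2" using e by (intro power_mono) auto
  then show "\<bar>corner A B L n s\<bar> \<le> 10 * (\<bar>A\<bar> + \<bar>B\<bar>) * L\<^sup>2"
    using le[OF bump_bounds(1)[OF pos(1)] bump_bounds(1)[OF pos(2)] refl refl, of "\<epsilon>\<^sup>2" "L\<^sup>2"]
    unfolding corner_def Let_def \<epsilon>_def[symmetric] by simp
  show "\<bar>corner1 A B L n s\<bar> \<le> 10 * (\<bar>A\<bar> + \<bar>B\<bar>) * L"
    using le[OF bump_bounds(2)[OF pos(1)] bump_bounds(2)[OF pos(2)] refl, of "- B" \<epsilon> L] e
    unfolding corner1_def Let_def \<epsilon>_def[symmetric] by simp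
  show "\<bar>corner2 A B L n s\<bar> \<le> 10 * (\<bar>A\<bar> + \<bar>B\<bar>)"
    using le[OF bump_bounds(3)[OF pos(1)] bump_bounds(3)[OF pos(2)] refl refl, of 1 1]
    unfolding corner2_def Let_def \<epsilon>_def[symmetric] by simp
qed

section \<open>Approximation by functions in the domain of the generator\<close>

lemma finite_uniform_bound:
  fixes P :: "'i \<Rightarrow> real \<Rightarrow> bool"
  assumes "finite I" "\<And>\<alpha>. \<alpha> \<in> I \<Longrightarrow> \<exists>C. P \<alpha> C" "\<And>\<alpha> C D. P \<alpha> C \<Longrightarrow> C \<le> D \<Longrightarrow> P \<alpha> D"
  obtains C where "\<And>\<alpha>. \<alpha> \<in> I \<Longrightarrow> P \<alpha> C"
proof -
  obtain c where c: "\<And>\<alpha>. \<alpha> \<in> I \<Longrightarrow> P \<alpha> (c \<alpha>)" using assms(2) by metis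
  show ?thesis
  proof (rule that[of "\<Sum>\<alpha>\<in>I. \<bar>c \<alpha>\<bar>"])
    fix \<alpha> assume a: "\<alpha> \<in> I"
    have "c \<alpha> \<le> \<bar>c \<alpha>\<bar>" by simp
    also have "\<dots> \<le> (\<Sum>\<alpha>\<in>I. \<bar>c \<alpha>\<bar>)" using assms(1) a by (intro member_le_sum) auto
    finally show "P \<alpha> (\<Sum>\<alpha>\<in>I. \<bar>c \<alpha>\<bar>)" by (rule assms(3)[OF c[OF a]])
  qed
qed

lemma outward_deriv_cong:
  "d1 N \<alpha> f v = d1 N \<alpha> u v \<Longrightarrow> outward_deriv N \<alpha> f v = outward_deriv N \<alpha> u v"
  by (auto simp: outward_deriv_def)

text \<open>
  A function \<open>u\<close> with the right slopes at the vertices can fail to be in the domain of the generator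
  only because \<open>\<mu> \<partial>\<^sup>2u + b \<partial>u\<close> does not extend continuously to the vertices. Corner corrections
  bring this expression to any prescribed value \<open>c v\<close> at \<open>v\<close>, on all edges ending there. They do not
  change the slopes, so the Kirchhoff condition only has to hold with \<open>c v\<close> in place of the generator.
  The functions \<open>\<beta> \<alpha>\<close> express that the drift extends continuously to the closed edges, so that finite
  corrections suffice. The value \<open>c v\<close> is free where \<open>\<eta> v = 0\<close> and at the boundary vertices.
  
  The approximants are eventually equal to \<open>u\<close> at each point and the images under the generator stay
  bounded, but they do not converge uniformly, which would force \<open>u\<close> into the domain.
\<close>

lemma generator_approximation:
  fixes c :: "'a::euclidean_space \<Rightarrow> real"
  assumes N: "is_network N" and u: "Ck_net 2 N u"
    and \<mu>: "\<And>\<alpha>. \<alpha> \<in> edges N \<Longrightarrow> \<mu> \<alpha> > 0"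
    and \<beta>: "\<And>\<alpha>. \<alpha> \<in> edges N \<Longrightarrow> continuous_on {0..len N \<alpha>} (\<beta> \<alpha>)"
    and drift: "\<And>\<alpha> x. \<alpha> \<in> edges N \<Longrightarrow> x \<in> edge N \<alpha> - verts N \<Longrightarrow> b x (a x) = \<beta> \<alpha> (coord N \<alpha> x)"
    and kirchhoff: "\<And>v. v \<in> verts N - bdry N \<Longrightarrow>
      \<eta> v * c v + (\<Sum>\<alpha>\<in>edges_at N v. \<mu> \<alpha> * \<gamma> v \<alpha> * outward_deriv N \<alpha> u v) = 0"
    and neumann: "\<And>v \<alpha>. v \<in> bdry N \<Longrightarrow> \<alpha> \<in> edges_at N v \<Longrightarrow> outward_deriv N \<alpha> u v = 0"
  obtains f g C where
    "\<And>n. gen_graph N \<mu> \<gamma> \<eta> b a (f n) (g n)"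
    "\<And>n x. x \<in> net N \<Longrightarrow> \<bar>f n x\<bar> \<le> C \<and> \<bar>g n x\<bar> \<le> C"
    "\<And>v. v \<in> verts N \<Longrightarrow> \<forall>\<^sub>F n in sequentially. f n v = u v \<and> g n v = c v"
    "\<And>\<alpha> x. \<alpha> \<in> edges N \<Longrightarrow> x \<in> edge N \<alpha> - verts N \<Longrightarrow> \<forall>\<^sub>F n in sequentially.
      f n x = u x \<and> g n x = \<mu> \<alpha> * d2 N \<alpha> u x + b x (a x) * d1 N \<alpha> u x"
proof -
  obtain u1 u2 where
    D1: "\<And>\<alpha> s. \<alpha> \<in> edges N \<Longrightarrow> s \<in> {0..len N \<alpha>} \<Longrightarrow>
      ((u \<circ> param N \<alpha>) has_real_derivative u1 \<alpha> s) (at s within {0..len N \<alpha>})" and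
    D2: "\<And>\<alpha> s. \<alpha> \<in> edges N \<Longrightarrow> s \<in> {0..len N \<alpha>} \<Longrightarrow>
      (u1 \<alpha> has_real_derivative u2 \<alpha> s) (at s within {0..len N \<alpha>})" and
    u1_cont: "\<And>\<alpha>. \<alpha> \<in> edges N \<Longrightarrow> continuous_on {0..len N \<alpha>} (u1 \<alpha>)" and
    u2_cont: "\<And>\<alpha>. \<alpha> \<in> edges N \<Longrightarrow> continuous_on {0..len N \<alpha>} (u2 \<alpha>)"
    using Ck_net_2E[OF u] by metis
  note L = edge_ends(3)[OF N]
  define G where "G \<alpha> s = \<mu> \<alpha> * u2 \<alpha> s + \<beta> \<alpha> s * u1 \<alpha> s" for \<alpha> s
  \<comment> \<open>The jumps of the second derivative that move the end values of \<open>G\<close> to \<open>c\<close>.\<close>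
  define A where "A \<alpha> = (c (src N \<alpha>) - G \<alpha> 0) / \<mu> \<alpha>" for \<alpha>
  define B where "B \<alpha> = (c (tgt N \<alpha>) - G \<alpha> (len N \<alpha>)) / \<mu> \<alpha>" for \<alpha>
  define w where "w n \<alpha> = corner (A \<alpha>) (B \<alpha>) (len N \<alpha>) n" for n \<alpha>
  define w1 where "w1 n \<alpha> = corner1 (A \<alpha>) (B \<alpha>) (len N \<alpha>) n" for n \<alpha>
  define w2 where "w2 n \<alpha> = corner2 (A \<alpha>) (B \<alpha>) (len N \<alpha>) n" for n \<alpha>
  define k where "k n \<alpha> s = \<mu> \<alpha> * (u2 \<alpha> s + w2 n \<alpha> s) + \<beta> \<alpha> s * (u1 \<alpha> s + w1 n \<alpha> s)" for n \<alpha> s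
  define f where "f n x = u x + glue N (w n) x" for n x
  define g where "g n = glue N (k n)" for n
  have w_ends: "w n \<alpha> 0 = 0 \<and> w n \<alpha> (len N \<alpha>) = 0"
    and w1_ends: "w1 n \<alpha> 0 = 0 \<and> w1 n \<alpha> (len N \<alpha>) = 0" if "\<alpha> \<in> edges N" for n \<alpha>
    using corner_ends[OF L[OF that]] by (simp_all add: w_def w1_def)
  have k_ends: "k n \<alpha> 0 = c (src N \<alpha>) \<and> k n \<alpha> (len N \<alpha>) = c (tgt N \<alpha>)" if "\<alpha> \<in> edges N" for n \<alpha>
    using corner_ends(5,6)[OF L[OF that]] w1_ends[OF that] \<mu>[OF that]
    by (simp add: k_def w2_def A_def B_def G_def distrib_left)
  have w_glue: "glue N (w n) x = w n \<alpha> (coord N \<alpha> x)"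
    and g_eq: "g n x = k n \<alpha> (coord N \<alpha> x)" if "\<alpha> \<in> edges N" "x \<in> edge N \<alpha>" for n \<alpha> x
    using glue_eq[OF N, of "w n" "\<lambda>_. 0", OF _ that] w_ends glue_eq[OF N, of "k n" c, OF _ that] k_ends
    by (simp_all add: g_def)
  have w_D: "(w n \<alpha> has_real_derivative w1 n \<alpha> s) (at s within S)"
    "(w1 n \<alpha> has_real_derivative w2 n \<alpha> s) (at s within S)" if "\<alpha> \<in> edges N" for n \<alpha> s S
    using DERIV_corner[OF L[OF that]] unfolding w_def w1_def w2_def
    by (auto intro: has_field_derivative_at_within)
  have f_eq: "f n (param N \<alpha> s) = (u \<circ> param N \<alpha>) s + w n \<alpha> s" if "\<alpha> \<in> edges N" "s \<in> {0..len N \<alpha>}" for n \<alpha> s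
    using that param_in_edge[OF L[OF that(1)] that(2)] L[OF that(1)]
    by (simp add: f_def w_glue coord_param)
  have f_D1: "((f n \<circ> param N \<alpha>) has_real_derivative u1 \<alpha> s + w1 n \<alpha> s) (at s within {0..len N \<alpha>})"
    if "\<alpha> \<in> edges N" "s \<in> {0..len N \<alpha>}" for n \<alpha> s
    by (rule has_field_derivative_transform_within[OF DERIV_add[OF D1[OF that] w_D(1)[OF that(1)]] zero_less_one that(2)])
      (use f_eq[OF that(1)] in auto)
  have f_D2: "((\<lambda>s. u1 \<alpha> s + w1 n \<alpha> s) has_real_derivative u2 \<alpha> s + w2 n \<alpha> s) (at s within {0..len N \<alpha>})"
    if "\<alpha> \<in> edges N" "s \<in> {0..len N \<alpha>}" for n \<alpha> s
    by (rule DERIV_add[OF D2[OF that] w_D(2)[OF that(1)]])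
  have w_cont: "continuous_on S (w n \<alpha>)" "continuous_on S (w1 n \<alpha>)" "continuous_on S (w2 n \<alpha>)"
    if "\<alpha> \<in> edges N" for n \<alpha> S
    using DERIV_continuous_on[OF w_D(1)[OF that]] DERIV_continuous_on[OF w_D(2)[OF that]]
      corner2_continuous[OF L[OF that]] by (auto simp: w2_def)
  have k_cont: "continuous_on {0..len N \<alpha>} (k n \<alpha>)" if "\<alpha> \<in> edges N" for n \<alpha>
    unfolding k_def[abs_def] using that by (intro continuous_intros u1_cont u2_cont \<beta> w_cont)
  have f_d1: "d1 N \<alpha> (f n) x = u1 \<alpha> (coord N \<alpha> x) + w1 n \<alpha> (coord N \<alpha> x)"
    and f_d2: "d2 N \<alpha> (f n) x = u2 \<alpha> (coord N \<alpha> x) + w2 n \<alpha> (coord N \<alpha> x)"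
    and u_d1: "d1 N \<alpha> u x = u1 \<alpha> (coord N \<alpha> x)"
    and u_d2: "d2 N \<alpha> u x = u2 \<alpha> (coord N \<alpha> x)"
    if "\<alpha> \<in> edges N" "x \<in> edge N \<alpha>" for n \<alpha> x
    using d1_eq[OF N that f_D1] d2_eq[OF N that f_D1 f_D2] d1_eq[OF N that D1] d2_eq[OF N that D1 D2] that(1)
    by auto
  have outward: "outward_deriv N \<alpha> (f n) v = outward_deriv N \<alpha> u v"
    if "v \<in> verts N" "\<alpha> \<in> edges_at N v" for v \<alpha> n
  proof -
    have a: "\<alpha> \<in> edges N" "v \<in> edge N \<alpha>" using that by (auto simp: edges_at_def)
    then have "coord N \<alpha> v = 0 \<or> coord N \<alpha> v = len N \<alpha>"
      using vertex_on_edge_is_end[OF N a(1) that(1) a(2)] coord_ends by metis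
    then show ?thesis
      using w1_ends[OF a(1)] by (intro outward_deriv_cong) (auto simp: f_d1 u_d1 a)
  qed
  have g_vertex: "g n v = c v" if v: "v \<in> verts N" for v n
  proof -
    obtain \<alpha> where a: "\<alpha> \<in> edges N" "v \<in> edge N \<alpha>" using vertex_in_net[OF N v] by (auto simp: net_def)
    show ?thesis
      using vertex_on_edge_is_end[OF N a(1) v a(2)] k_ends[OF a(1)] by (auto simp: g_eq[OF a] coord_ends)
  qed
  have bdry: "bdry N \<subseteq> verts N" by (auto simp: bdry_def)
  have edge_bound: "\<exists>C. \<forall>n. \<forall>s\<in>{0..len N \<alpha>}. \<bar>f n (param N \<alpha> s)\<bar> \<le> C \<and> \<bar>k n \<alpha> s\<bar> \<le> C"
    if a: "\<alpha> \<in> edges N" for \<alpha>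
  proof -
    let ?I = "{0..len N \<alpha>}"
    have "compact ?I" by simp
    note bd = compact_continuous_bounded[OF this]
    obtain C0 where C0: "\<And>s. s \<in> ?I \<Longrightarrow> \<bar>(u \<circ> param N \<alpha>) s\<bar> \<le> C0"
      using bd[OF DERIV_continuous_on[OF D1[OF a]]] by metis
    obtain C1 where C1: "\<And>s. s \<in> ?I \<Longrightarrow> \<bar>u1 \<alpha> s\<bar> \<le> C1" using bd[OF u1_cont[OF a]] by metis
    obtain C2 where C2: "\<And>s. s \<in> ?I \<Longrightarrow> \<bar>u2 \<alpha> s\<bar> \<le> C2" using bd[OF u2_cont[OF a]] by metis
    obtain C3 where C3: "\<And>s. s \<in> ?I \<Longrightarrow> \<bar>\<beta> \<alpha> s\<bar> \<le> C3" using bd[OF \<beta>[OF a]] by metis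
    define W where "W = 10 * (\<bar>A \<alpha>\<bar> + \<bar>B \<alpha>\<bar>)"
    have W: "\<bar>w n \<alpha> s\<bar> \<le> W * (len N \<alpha>)\<^sup>2" "\<bar>w1 n \<alpha> s\<bar> \<le> W * len N \<alpha>" "\<bar>w2 n \<alpha> s\<bar> \<le> W"
      if "s \<in> ?I" for s n
      using corner_bounds[OF that L[OF a]] unfolding w_def w1_def w2_def W_def by blast+
    let ?Cf = "C0 + W * (len N \<alpha>)\<^sup>2"
    let ?Cg = "\<mu> \<alpha> * (C2 + W) + C3 * (C1 + W * len N \<alpha>)"
    have f_le: "\<bar>f n (param N \<alpha> s)\<bar> \<le> ?Cf" if s: "s \<in> ?I" for n s
    proof -
      have "\<bar>(u \<circ> param N \<alpha>) s + w n \<alpha> s\<bar> \<le> \<bar>(u \<circ> param N \<alpha>) s\<bar> + \<bar>w n \<alpha> s\<bar>" by (rule abs_triangle_ineq)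
      also have "\<dots> \<le> ?Cf" using C0[OF s] W(1)[OF s] by (rule add_mono)
      finally show ?thesis by (simp add: f_eq[OF a s])
    qed
    have k_le: "\<bar>k n \<alpha> s\<bar> \<le> ?Cg" if s: "s \<in> ?I" for n s
    proof -
      have "\<bar>k n \<alpha> s\<bar> \<le> \<bar>\<mu> \<alpha>\<bar> * \<bar>u2 \<alpha> s + w2 n \<alpha> s\<bar> + \<bar>\<beta> \<alpha> s\<bar> * \<bar>u1 \<alpha> s + w1 n \<alpha> s\<bar>"
        unfolding k_def by (rule order_trans[OF abs_triangle_ineq]) (simp add: abs_mult)
      also have "\<dots> \<le> ?Cg"
      proof (intro add_mono mult_mono)
        show "\<bar>u2 \<alpha> s + w2 n \<alpha> s\<bar> \<le> C2 + W"
          using C2[OF s] W(3)[OF s, of n] by linarith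
        show "\<bar>u1 \<alpha> s + w1 n \<alpha> s\<bar> \<le> C1 + W * len N \<alpha>"
          using C1[OF s] W(2)[OF s, of n] by linarith
      qed (use \<mu>[OF a] C3[OF s] in auto)
      finally show ?thesis .
    qed
    show ?thesis
    proof (intro exI[of _ "max ?Cf ?Cg"] allI ballI conjI)
      fix n s assume s: "s \<in> ?I"
      show "\<bar>f n (param N \<alpha> s)\<bar> \<le> max ?Cf ?Cg" using f_le[OF s, of n] by (rule max.coboundedI1)
      show "\<bar>k n \<alpha> s\<bar> \<le> max ?Cf ?Cg" using k_le[OF s, of n] by (rule max.coboundedI2)
    qed
  qed
  have "finite (edges N)" using N by (simp add: is_network_def)
  then obtain C where C: "\<And>\<alpha>. \<alpha> \<in> edges N \<Longrightarrow>
      \<forall>n. \<forall>s\<in>{0..len N \<alpha>}. \<bar>f n (param N \<alpha> s)\<bar> \<le> C \<and> \<bar>k n \<alpha> s\<bar> \<le> C"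
    by (rule finite_uniform_bound[where P = "\<lambda>\<alpha> C. \<forall>n. \<forall>s\<in>{0..len N \<alpha>}. \<bar>f n (param N \<alpha> s)\<bar> \<le> C \<and> \<bar>k n \<alpha> s\<bar> \<le> C",
          OF _ edge_bound]) (blast intro: order_trans)+
  show ?thesis
  proof (rule that[of f g])
    show "\<bar>f n x\<bar> \<le> C \<and> \<bar>g n x\<bar> \<le> C" if x: "x \<in> net N" for n x
    proof -
      obtain \<alpha> where a: "\<alpha> \<in> edges N" "x \<in> edge N \<alpha>" using x by (auto simp: net_def)
      show ?thesis
        using C[OF a(1), rule_format, OF coord_range[OF a(2)], of n] by (simp add: g_eq[OF a] param_coord[OF a(2) L[OF a(1)]])
    qed
  next
    fix n
    show "gen_graph N \<mu> \<gamma> \<eta> b a (f n) (g n)"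
      unfolding gen_graph_def
    proof (intro conjI ballI)
      have "continuous_on (net N) (glue N (w n))"
        by (rule glue_continuous[OF N, of _ "\<lambda>_. 0"]) (use w_ends w_cont in auto)
      then have "continuous_on (net N) (f n)"
        using u unfolding f_def[abs_def] Ck_net_def by (intro continuous_intros) auto
      moreover have "Ck_on 2 {0..len N \<alpha>} (f n \<circ> param N \<alpha>)" if a: "\<alpha> \<in> edges N" for \<alpha>
      proof -
        have 1: "\<forall>s\<in>{0..len N \<alpha>}. ((f n \<circ> param N \<alpha>) has_real_derivative u1 \<alpha> s + w1 n \<alpha> s) (at s within {0..len N \<alpha>})"
          using f_D1[OF a] by blast
        have 2: "\<forall>s\<in>{0..len N \<alpha>}. ((\<lambda>s. u1 \<alpha> s + w1 n \<alpha> s) has_real_derivative u2 \<alpha> s + w2 n \<alpha> s) (at s within {0..len N \<alpha>})"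
          using f_D2[OF a] by blast
        have 3: "continuous_on {0..len N \<alpha>} (\<lambda>s. u2 \<alpha> s + w2 n \<alpha> s)"
          by (intro continuous_on_add u2_cont w_cont a)
        show ?thesis
          unfolding numeral_2_eq_2 Ck_on.simps
          by (rule exI, rule conjI, rule 1, rule exI, rule conjI, rule 2, rule 3)
      qed
      ultimately show "Ck_net 2 N (f n)" by (simp add: Ck_net_def)
      show "continuous_on (net N) (g n)"
        unfolding g_def by (rule glue_continuous[OF N, of _ c]) (use k_ends k_cont in auto)
    next
      fix \<alpha> x assume a: "\<alpha> \<in> edges N" and x: "x \<in> edge N \<alpha> - verts N"
      then show "g n x = \<mu> \<alpha> * d2 N \<alpha> (f n) x + b x (a x) * d1 N \<alpha> (f n) x"
        using drift[OF a x] by (simp add: g_eq k_def f_d1 f_d2)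
    next
      fix v assume v: "v \<in> verts N - bdry N"
      then show "\<eta> v * g n v + (\<Sum>\<alpha>\<in>edges_at N v. \<mu> \<alpha> * \<gamma> v \<alpha> * outward_deriv N \<alpha> (f n) v) = 0"
        using kirchhoff[OF v] by (simp add: g_vertex outward)
    next
      fix v \<alpha> assume "v \<in> bdry N" "\<alpha> \<in> edges_at N v"
      then show "outward_deriv N \<alpha> (f n) v = 0" using neumann outward bdry by (metis subsetD)
    qed
  next
    show "\<forall>\<^sub>F n in sequentially. f n v = u v \<and> g n v = c v" if v: "v \<in> verts N" for v
    proof -
      obtain \<alpha> where a: "\<alpha> \<in> edges N" "v \<in> edge N \<alpha>" using vertex_in_net[OF N v] by (auto simp: net_def)
      have "glue N (w n) v = 0" for n
        using vertex_on_edge_is_end[OF N a(1) v a(2)] w_ends[OF a(1)] by (auto simp: w_glue[OF a] coord_ends)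
      then show ?thesis using v by (simp add: f_def g_vertex)
    qed
  next
    fix \<alpha> x assume a: "\<alpha> \<in> edges N" and x: "x \<in> edge N \<alpha> - verts N"
    have "coord N \<alpha> x \<in> {0<..<len N \<alpha>}" using interior_point_iff[OF N a] x by auto
    then have "\<forall>\<^sub>F n in sequentially. w n \<alpha> (coord N \<alpha> x) = 0 \<and> w1 n \<alpha> (coord N \<alpha> x) = 0 \<and> w2 n \<alpha> (coord N \<alpha> x) = 0"
      unfolding w_def w1_def w2_def by (intro corner_eventually_zero) auto
    then show "\<forall>\<^sub>F n in sequentially. f n x = u x \<and> g n x = \<mu> \<alpha> * d2 N \<alpha> u x + b x (a x) * d1 N \<alpha> u x"
      by (rule eventually_mono) (use a x drift[OF a x] in \<open>simp add: f_def w_glue g_eq k_def u_d1 u_d2\<close>)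
  qed
qed

section \<open>Bounds on the cost\<close>

text \<open>
  The bound covers non-integrable \<open>f\<close>, whose integral is \<open>0\<close> by convention: the running cost of an
  arbitrary control is only known to be bounded.
\<close>

lemma abs_integral_le:
  fixes f g :: "'b \<Rightarrow> real"
  assumes "integrable M g" "\<And>x. x \<in> space M \<Longrightarrow> \<bar>f x\<bar> \<le> g x"
  shows "\<bar>integral\<^sup>L M f\<bar> \<le> integral\<^sup>L M g"
proof (cases "integrable M f")
  case True
  have "\<bar>integral\<^sup>L M f\<bar> \<le> (LINT x|M. \<bar>f x\<bar>)" by (rule integral_abs_bound)
  also have "\<dots> \<le> integral\<^sup>L M g" using True assms by (intro integral_mono) auto
  finally show ?thesis .
next
  case False
  have "0 \<le> integral\<^sup>L M g" using assms(2) by (intro integral_nonneg_AE AE_I2) (force intro: order_trans[OF abs_ge_zero])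
  then show ?thesis using False by (simp add: not_integrable_integral_eq)
qed

lemma expected_discounted_bound:
  fixes lam C :: real
  assumes M: "prob_space M" and lam: "lam > 0"
    and q: "\<And>\<omega> s. \<omega> \<in> space M \<Longrightarrow> s \<ge> 0 \<Longrightarrow> \<bar>q s \<omega>\<bar> \<le> C"
  shows "\<bar>LINT \<omega>|M. (LINT s:{0..}|lborel. exp (- lam * s) * q s \<omega>)\<bar>
    \<le> C * (LINT s:{0..}|lborel. exp (- lam * s))"
proof -
  interpret prob_space M by fact
  let ?d = "\<lambda>s. indicator {0..} s * exp (- lam * s) :: real"
  have int: "integrable lborel (\<lambda>s. C * ?d s)"
    using discount_integrable[OF lam] by simp
  have "\<bar>LINT s:{0..}|lborel. exp (- lam * s) * q s \<omega>\<bar> \<le> C * (LINT s:{0..}|lborel. exp (- lam * s))"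
    if w: "\<omega> \<in> space M" for \<omega>
  proof -
    have "\<bar>LINT s:{0..}|lborel. exp (- lam * s) * q s \<omega>\<bar> \<le> (LINT s|lborel. C * ?d s)"
      unfolding set_lebesgue_integral_def
      by (rule abs_integral_le[OF int]) (use q[OF w] in \<open>auto simp: abs_mult mult.commute split: split_indicator\<close>)
    then show ?thesis by (simp add: set_lebesgue_integral_def)
  qed
  then show ?thesis
    using abs_integral_le[of M "\<lambda>_. C * (LINT s:{0..}|lborel. exp (- lam * s))"] by (simp add: prob_space)
qed

section \<open>Admissible controls and the running cost\<close>

text \<open>
  The essential bound on a control holds everywhere inside the edges: the set where it fails is open,
  by continuity, and negligible, hence empty.
\<close>

lemma control_bound:
  assumes N: "is_network N" and a: "a \<in> controls N R" and e: "\<alpha> \<in> edges N" and s: "s \<in> {0<..<len N \<alpha>}"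
  shows "\<bar>a (param N \<alpha> s)\<bar> \<le> R"
proof -
  let ?S = "{0<..<len N \<alpha>}"
  let ?f = "\<lambda>s. \<bar>a (param N \<alpha> s)\<bar>"
  have cont: "continuous_on ?S ?f"
    using a e by (auto simp: controls_def PC_net_def comp_def intro!: continuous_intros)
  have "esssup (lebesgue_on ?S) (\<lambda>s. ereal (?f s)) \<le> PC_norm N a"
    unfolding PC_norm_def using N e by (intro Max_ge) (auto simp: is_network_def)
  also have "\<dots> \<le> ereal R" using a by (simp add: controls_def)
  finally have le: "esssup (lebesgue_on ?S) (\<lambda>s. ereal (?f s)) \<le> ereal R" .
  have "AE s in lebesgue_on ?S. ?f s \<le> R"
    using esssup_AE[of "\<lambda>s. ereal (?f s)" "lebesgue_on ?S"] by eventually_elim (use le order_trans in force)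
  then have ae: "AE s in lebesgue. s \<in> ?S \<longrightarrow> ?f s \<le> R"
    by (subst (asm) AE_restrict_space_iff) auto
  define B where "B = ?S \<inter> ?f -` {R<..}"
  have B: "open B"
    unfolding B_def using cont by (intro continuous_open_preimage) auto
  have "B \<in> null_sets lebesgue"
  proof (rule AE_iff_null_sets[THEN iffD2])
    show "B \<in> sets lebesgue" using borel_open[OF B] by simp
    show "AE s in lebesgue. s \<notin> B" using ae by eventually_elim (auto simp: B_def)
  qed
  then have "negligible B" by (simp add: negligible_iff_null_sets)
  then have "B = {}" using open_not_negligible[OF B] by blast
  then show ?thesis using s by (force simp: B_def)
qed

lemma edgewise_continuous_control:
  assumes N: "is_network N" and ne: "edges N \<noteq> {}"
    and k: "\<And>\<alpha>. \<alpha> \<in> edges N \<Longrightarrow> continuous_on {0..len N \<alpha>} (k \<alpha>)"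
    and k_le: "\<And>\<alpha> s. \<alpha> \<in> edges N \<Longrightarrow> s \<in> {0..len N \<alpha>} \<Longrightarrow> \<bar>k \<alpha> s\<bar> \<le> R"
    and a: "\<And>\<alpha> s. \<alpha> \<in> edges N \<Longrightarrow> s \<in> {0<..<len N \<alpha>} \<Longrightarrow> a (param N \<alpha> s) = k \<alpha> s"
  shows "a \<in> controls N R"
proof -
  have cont: "continuous_on {0<..<len N \<alpha>} (a \<circ> param N \<alpha>)" if e: "\<alpha> \<in> edges N" for \<alpha>
    by (rule continuous_on_eq[OF continuous_on_subset[OF k[OF e]]]) (use a[OF e] in auto)
  have "PC_net N a"
    unfolding PC_net_def
  proof (intro ballI conjI cont)
    fix \<alpha> assume e: "\<alpha> \<in> edges N"
    note L = edge_ends(3)[OF N e]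
    have "(k \<alpha> \<longlongrightarrow> k \<alpha> 0) (at 0 within {0..len N \<alpha>})" "(k \<alpha> \<longlongrightarrow> k \<alpha> (len N \<alpha>)) (at (len N \<alpha>) within {0..len N \<alpha>})"
      using k[OF e] L by (auto simp: continuous_on)
    then have lims: "(k \<alpha> \<longlongrightarrow> k \<alpha> 0) (at_right 0)" "(k \<alpha> \<longlongrightarrow> k \<alpha> (len N \<alpha>)) (at_left (len N \<alpha>))"
      using L by (simp_all add: at_within_Icc_at_right at_within_Icc_at_left)
    have "\<forall>\<^sub>F s in at_right 0. k \<alpha> s = (a \<circ> param N \<alpha>) s"
      using eventually_at_right_real[OF L] by eventually_elim (use a[OF e] in auto)
    then show "\<exists>l. ((a \<circ> param N \<alpha>) \<longlongrightarrow> l) (at_right 0)" using lims(1) by (blast intro: Lim_transform_eventually)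
    have "\<forall>\<^sub>F s in at_left (len N \<alpha>). k \<alpha> s = (a \<circ> param N \<alpha>) s"
      using eventually_at_left_real[OF L] by eventually_elim (use a[OF e] in auto)
    then show "\<exists>l. ((a \<circ> param N \<alpha>) \<longlongrightarrow> l) (at_left (len N \<alpha>))" using lims(2) by (blast intro: Lim_transform_eventually)
  qed
  moreover have "PC_norm N a \<le> ereal R"
    unfolding PC_norm_def
  proof (subst Max_le_iff)
    show "\<forall>z\<in>(\<lambda>\<alpha>. esssup (lebesgue_on {0<..<len N \<alpha>}) (\<lambda>s. ereal \<bar>a (param N \<alpha> s)\<bar>)) ` edges N. z \<le> ereal R"
    proof safe
      fix \<alpha> assume e: "\<alpha> \<in> edges N"
      show "esssup (lebesgue_on {0<..<len N \<alpha>}) (\<lambda>s. ereal \<bar>a (param N \<alpha> s)\<bar>) \<le> ereal R"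
      proof (rule esssup_I)
        have "continuous_on {0<..<len N \<alpha>} (\<lambda>s. \<bar>a (param N \<alpha> s)\<bar>)"
          using cont[OF e] by (intro continuous_intros) (simp add: comp_def)
        then have "(\<lambda>s. \<bar>a (param N \<alpha> s)\<bar>) \<in> borel_measurable (lebesgue_on {0<..<len N \<alpha>})"
          by (rule continuous_imp_measurable_on_sets_lebesgue) auto
        then show "(\<lambda>s. ereal \<bar>a (param N \<alpha> s)\<bar>) \<in> borel_measurable (lebesgue_on {0<..<len N \<alpha>})"
          by simp
        show "AE s in lebesgue_on {0<..<len N \<alpha>}. ereal \<bar>a (param N \<alpha> s)\<bar> \<le> ereal R"
          using a[OF e] k_le[OF e] by (intro AE_I2) auto
      qed
    qed
  qed (use N ne in \<open>auto simp: is_network_def\<close>)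
  ultimately show ?thesis by (simp add: controls_def)
qed

lemma running_cost_bounded:
  fixes l :: "'a::euclidean_space \<Rightarrow> real \<Rightarrow> real"
  assumes N: "is_network N"
    and l: "\<And>\<alpha>. \<alpha> \<in> edges N \<Longrightarrow> continuous_on (edge N \<alpha> \<times> UNIV) (\<lambda>(x, a). l x a)"
  obtains C where "\<And>x a. x \<in> net N \<Longrightarrow> \<bar>a\<bar> \<le> R \<Longrightarrow> \<bar>l x a\<bar> \<le> C"
proof -
  have "\<exists>C. \<forall>x\<in>edge N \<alpha>. \<forall>a. \<bar>a\<bar> \<le> R \<longrightarrow> \<bar>l x a\<bar> \<le> C" if e: "\<alpha> \<in> edges N" for \<alpha>
  proof -
    have "compact (edge N \<alpha> \<times> {-R..R})" by (intro compact_Times) (auto simp: edge_def)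
    moreover have "continuous_on (edge N \<alpha> \<times> {-R..R}) (\<lambda>(x, a). l x a)"
      by (rule continuous_on_subset[OF l[OF e]]) auto
    ultimately obtain C where "\<And>z. z \<in> edge N \<alpha> \<times> {-R..R} \<Longrightarrow> \<bar>case z of (x, a) \<Rightarrow> l x a\<bar> \<le> C"
      using compact_continuous_bounded by metis
    then have "\<forall>x\<in>edge N \<alpha>. \<forall>a. \<bar>a\<bar> \<le> R \<longrightarrow> \<bar>l x a\<bar> \<le> C" by (auto simp: abs_le_iff)
    then show ?thesis by blast
  qed
  note edge_bound = this
  have "finite (edges N)" using N by (simp add: is_network_def)
  then obtain C where "\<And>\<alpha>. \<alpha> \<in> edges N \<Longrightarrow> \<forall>x\<in>edge N \<alpha>. \<forall>a. \<bar>a\<bar> \<le> R \<longrightarrow> \<bar>l x a\<bar> \<le> C"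
    by (rule finite_uniform_bound[where P = "\<lambda>\<alpha> C. \<forall>x\<in>edge N \<alpha>. \<forall>a. \<bar>a\<bar> \<le> R \<longrightarrow> \<bar>l x a\<bar> \<le> C", OF _ edge_bound])
      (blast intro: order_trans)+
  then show ?thesis by (intro that) (auto simp: net_def)
qed

section \<open>Optimality of the feedback control\<close>

theorem proposition4p8:
  fixes N :: "('a::euclidean_space, 'i) network"
    and \<mu> :: "'i \<Rightarrow> real" and \<gamma> :: "'a \<Rightarrow> 'i \<Rightarrow> real" and \<eta> \<theta> :: "'a \<Rightarrow> real"
    and b l :: "'a \<Rightarrow> real \<Rightarrow> real" and F u :: "'a \<Rightarrow> real" and lam R :: real
    and M :: "('a \<Rightarrow> real) \<Rightarrow> 'a \<Rightarrow> 'w measure"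
    and X :: "('a \<Rightarrow> real) \<Rightarrow> 'a \<Rightarrow> real \<Rightarrow> 'w \<Rightarrow> 'a"
  assumes "is_network N"
    and "lam > 0" and "R > 0"
    and "\<forall>\<alpha>\<in>edges N. \<mu> \<alpha> > 0"
    and "\<forall>v\<in>verts N - bdry N. \<forall>\<alpha>\<in>edges_at N v. \<gamma> v \<alpha> > 0"
    and "\<forall>v\<in>verts N - bdry N. \<eta> v \<ge> 0"
    and "\<forall>v\<in>verts N - bdry N. (\<Sum>\<alpha>\<in>edges_at N v. \<mu> \<alpha> * \<gamma> v \<alpha>) = 1"
    and "\<forall>\<alpha>\<in>edges N. continuous_on (edge N \<alpha> \<times> UNIV) (\<lambda>(x, a). b x a)"
    and "\<forall>\<alpha>\<in>edges N. continuous_on (edge N \<alpha> \<times> UNIV) (\<lambda>(x, a). l x a)"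
    and "PC_net N F"
    and "\<forall>a\<in>controls N R. \<forall>x\<in>net N. controlled_process N \<mu> \<gamma> \<eta> b a x (M a x) (X a x)"
    and "H4 N b l R"
    and "Ck_net 2 N u"
    and "HJB_solution N \<mu> \<gamma> \<eta> \<theta> (hamiltonian b l R) F lam u"
  shows "\<forall>x\<in>net N. u x \<ge> value_fun N \<theta> l F lam R M X x"
proof
  note N = assms(1) and lam = assms(2)
  fix x0 assume x0: "x0 \<in> net N"
  have fin: "finite (verts N)" and ne: "edges N \<noteq> {}"
    using N x0 by (auto simp: is_network_def net_def)
  let ?H = "hamiltonian b l R"
  obtain u1 where
    D1: "\<And>\<alpha> s. \<alpha> \<in> edges N \<Longrightarrow> s \<in> {0..len N \<alpha>} \<Longrightarrow>
      ((u \<circ> param N \<alpha>) has_real_derivative u1 \<alpha> s) (at s within {0..len N \<alpha>})" and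
    u1_cont: "\<And>\<alpha>. \<alpha> \<in> edges N \<Longrightarrow> continuous_on {0..len N \<alpha>} (u1 \<alpha>)"
    using Ck_net_2E[OF \<open>Ck_net 2 N u\<close>] by metis
  have u_d1: "d1 N \<alpha> u x = u1 \<alpha> (coord N \<alpha> x)" if "\<alpha> \<in> edges N" "x \<in> edge N \<alpha>" for \<alpha> x
    by (rule d1_eq[OF N that D1[OF that(1)]])

  \<comment> \<open>The feedback control: the maximizer of the Hamiltonian at the slope of \<open>u\<close>. At a vertex it depends on the chosen edge, but it is read only off the vertices.\<close>
  define A where "A x p = (THE a. \<bar>a\<bar> \<le> R \<and> ?H x p = - b x a * p - l x a)" for x p
  have A: "\<bar>A x p\<bar> \<le> R" "?H x p = - b x (A x p) * p - l x (A x p)"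
    if "\<alpha> \<in> edges N" "x \<in> edge N \<alpha>" for \<alpha> x p
  proof -
    have "\<exists>!a. \<bar>a\<bar> \<le> R \<and> ?H x p = - b x a * p - l x a"
      using \<open>H4 N b l R\<close> that unfolding H4_def by blast
    from theI'[OF this] show "\<bar>A x p\<bar> \<le> R" "?H x p = - b x (A x p) * p - l x (A x p)"
      by (simp_all add: A_def)
  qed
  have A_cont: "continuous_on (edge N \<alpha> \<times> UNIV) (\<lambda>(x, p). A x p)" if "\<alpha> \<in> edges N" for \<alpha>
    using \<open>H4 N b l R\<close> that unfolding H4_def A_def by blast
  define k where "k \<alpha> s = A (param N \<alpha> s) (u1 \<alpha> s)" for \<alpha> s
  define \<beta> where "\<beta> \<alpha> s = b (param N \<alpha> s) (k \<alpha> s)" for \<alpha> s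
  define a where "a x = A x (d1 N (chosen_edge N x) u x)" for x
  note L = edge_ends(3)[OF N]
  have k_cont: "continuous_on {0..len N \<alpha>} (k \<alpha>)" if e: "\<alpha> \<in> edges N" for \<alpha>
  proof -
    have "continuous_on {0..len N \<alpha>} (\<lambda>s. case (param N \<alpha> s, u1 \<alpha> s) of (x, p) \<Rightarrow> A x p)"
      by (rule continuous_on_compose2[OF A_cont[OF e]], intro continuous_on_Pair param_continuous u1_cont e)
        (use param_in_edge[OF L[OF e]] in auto)
    then show ?thesis by (simp add: k_def[abs_def])
  qed
  have \<beta>_cont: "continuous_on {0..len N \<alpha>} (\<beta> \<alpha>)" if e: "\<alpha> \<in> edges N" for \<alpha>
  proof -
    have "continuous_on (edge N \<alpha> \<times> UNIV) (\<lambda>(x, a). b x a)" using assms(8) e by blast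
    then have "continuous_on {0..len N \<alpha>} (\<lambda>s. case (param N \<alpha> s, k \<alpha> s) of (x, p) \<Rightarrow> b x p)"
      by (rule continuous_on_compose2, intro continuous_on_Pair param_continuous k_cont e)
        (use param_in_edge[OF L[OF e]] in auto)
    then show ?thesis by (simp add: \<beta>_def[abs_def])
  qed
  have a_eq: "a x = A x (d1 N \<alpha> u x)" if "\<alpha> \<in> edges N" "x \<in> edge N \<alpha> - verts N" for \<alpha> x
    using that chosen_edge_interior[OF N that(1)] by (simp add: a_def)
  have a_control: "a \<in> controls N R"
  proof (rule edgewise_continuous_control[OF N ne k_cont])
    fix \<alpha> s assume e: "\<alpha> \<in> edges N"
    show "\<bar>k \<alpha> s\<bar> \<le> R" if "s \<in> {0..len N \<alpha>}"
      using A(1)[OF e param_in_edge[OF L[OF e] that]] by (simp add: k_def)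
    show "a (param N \<alpha> s) = k \<alpha> s" if s: "s \<in> {0<..<len N \<alpha>}"
      using param_interior[OF N e s] s L[OF e] by (simp add: a_eq[OF e] k_def u_d1[OF e] coord_param)
  qed
  have drift: "b x (a x) = \<beta> \<alpha> (coord N \<alpha> x)" if "\<alpha> \<in> edges N" "x \<in> edge N \<alpha> - verts N" for \<alpha> x
    using that param_coord[of x N \<alpha>] L[OF that(1)] by (simp add: a_eq[OF that] \<beta>_def k_def u_d1)

  note hjb = \<open>HJB_solution N \<mu> \<gamma> \<eta> \<theta> ?H F lam u\<close>[unfolded HJB_solution_def]
  \<comment> \<open>The values for which \<open>\<lambda> u - c\<close> is the running cost at the vertices, namely \<open>\<theta>\<close> inside and \<open>0\<close> at the boundary.\<close>
  define c where "c v = lam * u v - (if v \<in> bdry N then 0 else \<theta> v)" for v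
  have kirchhoff: "\<eta> v * c v + (\<Sum>\<alpha>\<in>edges_at N v. \<mu> \<alpha> * \<gamma> v \<alpha> * outward_deriv N \<alpha> u v) = 0"
    if "v \<in> verts N - bdry N" for v
    using hjb that by (simp add: c_def algebra_simps)
  have neumann: "outward_deriv N \<alpha> u v = 0" if "v \<in> bdry N" "\<alpha> \<in> edges_at N v" for v \<alpha>
    using hjb that by blast
  obtain f g C where gen: "\<And>n. gen_graph N \<mu> \<gamma> \<eta> b a (f n) (g n)"
    and fg_le: "\<And>n x. x \<in> net N \<Longrightarrow> \<bar>f n x\<bar> \<le> C \<and> \<bar>g n x\<bar> \<le> C"
    and fg_vertex: "\<And>v. v \<in> verts N \<Longrightarrow> \<forall>\<^sub>F n in sequentially. f n v = u v \<and> g n v = c v"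
    and fg_interior: "\<And>\<alpha> x. \<alpha> \<in> edges N \<Longrightarrow> x \<in> edge N \<alpha> - verts N \<Longrightarrow> \<forall>\<^sub>F n in sequentially.
      f n x = u x \<and> g n x = \<mu> \<alpha> * d2 N \<alpha> u x + b x (a x) * d1 N \<alpha> u x"
    by (rule generator_approximation[where b = b and a = a and c = c and \<eta> = \<eta> and \<gamma> = \<gamma>,
        OF N \<open>Ck_net 2 N u\<close> assms(4)[rule_format] \<beta>_cont drift kirchhoff neumann]; (assumption | rule that))

  \<comment> \<open>The running cost; by the equation it is the limit of the residuals \<open>\<lambda> f\<^sub>n - g\<^sub>n\<close> when \<open>a\<close> is the feedback control.\<close>
  define q where "q a x = (l x (a x) + F x) * indicator (- verts N) x
      + (\<Sum>v\<in>verts N - bdry N. \<theta> v * indicator {v} x)" for a x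
  have q_vertex: "q a' v = lam * u v - c v" if "v \<in> verts N" for v a'
  proof -
    have "(\<Sum>w\<in>verts N - bdry N. \<theta> w * indicator {w} v) = (\<Sum>w\<in>verts N - bdry N. if v = w then \<theta> w else 0)"
      by (intro sum.cong) auto
    then show ?thesis using that fin by (simp add: q_def c_def)
  qed
  have q_interior: "q a' x = l x (a' x) + F x" if "x \<notin> verts N" for x a'
  proof -
    have "(\<Sum>w\<in>verts N - bdry N. \<theta> w * indicator {w} x) = 0"
      using that by (intro sum.neutral) (auto split: split_indicator)
    then show ?thesis using that by (simp add: q_def)
  qed
  have residual: "\<forall>\<^sub>F n in sequentially. f n x = u x \<and> lam * f n x - g n x = q a x" if x: "x \<in> net N" for x
  proof (cases "x \<in> verts N")
    case True
    show ?thesis using fg_vertex[OF True] by eventually_elim (simp add: q_vertex[OF True])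
  next
    case False
    obtain \<alpha> where e: "\<alpha> \<in> edges N" "x \<in> edge N \<alpha>" using x by (auto simp: net_def)
    then have i: "x \<in> edge N \<alpha> - verts N" using False by blast
    have "- \<mu> \<alpha> * d2 N \<alpha> u x + ?H x (d1 N \<alpha> u x) + lam * u x = F x" using hjb e i by blast
    moreover have "?H x (d1 N \<alpha> u x) = - b x (a x) * d1 N \<alpha> u x - l x (a x)"
      using A(2)[OF e] by (simp add: a_eq[OF e(1) i])
    ultimately have eq: "lam * u x - (\<mu> \<alpha> * d2 N \<alpha> u x + b x (a x) * d1 N \<alpha> u x) = q a x"
      by (simp add: q_interior[OF False])
    show ?thesis using fg_interior[OF e(1) i] by eventually_elim (use eq in simp)
  qed
  have residual_le: "\<bar>lam * f n x - g n x\<bar> \<le> lam * C + C" if x: "x \<in> net N" for n x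
  proof -
    have "\<bar>lam * f n x\<bar> \<le> lam * C" using fg_le[OF x] lam by (simp add: abs_mult)
    then show ?thesis using fg_le[OF x, of n] by linarith
  qed

  have cost_eq: "cost N \<theta> l F lam a' (M a' x0) (X a' x0) =
      (LINT \<omega>|M a' x0. (LINT s:{0..}|lborel. exp (- lam * s) * q a' (X a' x0 s \<omega>)))" for a'
    by (simp add: cost_def q_def)
  have "controlled_process N \<mu> \<gamma> \<eta> b a x0 (M a x0) (X a x0)" using assms(11) a_control x0 by blast
  then obtain T where T: "feller_semigroup (net N) T"
    "\<And>f g. semigroup_generator (net N) T f g \<longleftrightarrow> gen_graph N \<mu> \<gamma> \<eta> b a f g"
    "continuous_feller_process (net N) T x0 (M a x0) (X a x0)"
    unfolding controlled_process_def by blast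
  interpret feller_process_on "net N" T x0 "M a x0" "X a x0"
    using T x0 net_compact[OF N] by unfold_locales
  have value_attained: "cost N \<theta> l F lam a (M a x0) (X a x0) = u x0"
    unfolding cost_eq
  proof (rule resolvent_formula_limit[OF _ lam])
    show "semigroup_generator (net N) T (f n) (g n)" for n using T(2) gen by blast
    show "(\<lambda>n. f n x0) \<longlonglongrightarrow> u x0"
      by (rule tendsto_eventually, rule eventually_mono[OF residual[OF x0]], rule conjunct1)
    show "(\<lambda>n. lam * f n y - g n y) \<longlonglongrightarrow> q a y" if "y \<in> net N" for y
      by (rule tendsto_eventually, rule eventually_mono[OF residual[OF that]], rule conjunct2)
    show "\<bar>lam * f n y - g n y\<bar> \<le> lam * C + C" if "y \<in> net N" for n y by (rule residual_le[OF that])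
  qed

  obtain Cl where Cl: "\<And>x a. x \<in> net N \<Longrightarrow> \<bar>a\<bar> \<le> R \<Longrightarrow> \<bar>l x a\<bar> \<le> Cl"
    using running_cost_bounded[OF N assms(9)[rule_format]] by metis
  \<comment> \<open>The infimum over a set that is unbounded below would be an arbitrary real. The running cost of the feedback control is a limit of bounded residuals, and another control changes it only through \<open>l\<close>.\<close>
  have q_le: "\<bar>q a' x\<bar> \<le> lam * C + C + 2 * Cl" if x: "x \<in> net N" and a': "a' \<in> controls N R" for x a'
  proof -
    obtain n where "lam * f n x - g n x = q a x"
      using eventually_happens[OF residual[OF x]] by auto
    then have qa: "\<bar>q a x\<bar> \<le> lam * C + C" using residual_le[OF x, of n] by simp
    have Cl_pos: "0 \<le> Cl" using Cl[OF x, of 0] \<open>R > 0\<close> by simp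
    show ?thesis
    proof (cases "x \<in> verts N")
      case True
      then show ?thesis using qa Cl_pos by (simp add: q_vertex)
    next
      case False
      obtain \<alpha> where e: "\<alpha> \<in> edges N" "x \<in> edge N \<alpha>" using x by (auto simp: net_def)
      have "\<bar>a'' x\<bar> \<le> R" if "a'' \<in> controls N R" for a''
        using control_bound[OF N that e(1), of "coord N \<alpha> x"] interior_point_iff[OF N e] False
          param_coord[OF e(2) L[OF e(1)]] by auto
      then have "\<bar>l x (a' x)\<bar> \<le> Cl" "\<bar>l x (a x)\<bar> \<le> Cl" using Cl[OF x] a' a_control by auto
      then show ?thesis using qa unfolding q_interior[OF False] by linarith
    qed
  qed
  have "bdd_below ((\<lambda>a. cost N \<theta> l F lam a (M a x0) (X a x0)) ` controls N R)"
  proof (rule bdd_belowI2)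
    fix a' assume a': "a' \<in> controls N R"
    then have P: "controlled_process N \<mu> \<gamma> \<eta> b a' x0 (M a' x0) (X a' x0)" using assms(11) x0 by blast
    then have "prob_space (M a' x0)" "\<And>\<omega> s. \<omega> \<in> space (M a' x0) \<Longrightarrow> s \<ge> 0 \<Longrightarrow> X a' x0 s \<omega> \<in> net N"
      by (auto simp: controlled_process_def continuous_feller_process_def)
    then have "\<bar>cost N \<theta> l F lam a' (M a' x0) (X a' x0)\<bar>
        \<le> (lam * C + C + 2 * Cl) * (LINT s:{0..}|lborel. exp (- lam * s))"
      unfolding cost_eq by (intro expected_discounted_bound lam q_le a')
    then show "- ((lam * C + C + 2 * Cl) * (LINT s:{0..}|lborel. exp (- lam * s)))
        \<le> cost N \<theta> l F lam a' (M a' x0) (X a' x0)"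
      by linarith
  qed
  then have "value_fun N \<theta> l F lam R M X x0 \<le> cost N \<theta> l F lam a (M a x0) (X a x0)"
    unfolding value_fun_def using a_control by (rule cINF_lower)
  then show "u x0 \<ge> value_fun N \<theta> l F lam R M X x0" by (simp add: value_attained)
qed

end
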